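(* Let $H\subset\mathbb{R}$ be a bounded open set, $\mathcal{B}$ a finite index set and $m\ge1$ an integer. Assume: (H4.1) $g_b\in C^m(\bar H)$ and $g_b(x)>0$ for all $x\in\bar H$ and $b\in\mathcal{B}$; (H4.2) $\theta_b:H\to H$ is a $C^m$ map for all $b\in\mathcal{B}$; (H4.3) there exist a positive integer $\mu$ and a constant $\kappa<1$ such that $|\theta_\omega(x)-\theta_\omega(y)|\le\kappa|x-y|$ for all $\omega\in\mathcal{B}_\mu$ and $x,y\in H$. For $s\in\mathbb{R}$ define $\Lambda_s:C^m(\bar H)\to C^m(\bar H)$ by $(\Lambda_sw)(x)=\sum_{b\in\mathcal{B}}[g_b(x)]^sw(\theta_b(x))$. Then $s\mapsto r(\Lambda_s)$ is log convex, i.e., $s\mapsto\log(r(\Lambda_s))$ is convex on $[0,\infty)$.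
   Context: $C^m(\bar H)$ is the real Banach space of $C^m$ functions $w:H\to\mathbb{R}$ all of whose derivatives of order $\le m$ extend continuously to $\bar H$. $\mathcal{B}_\mu=\{\omega=(j_1,\dots,j_\mu):j_k\in\mathcal{B}\}$ and $\theta_\omega=\theta_{j_\mu}\circ\cdots\circ\theta_{j_1}$. $r(\cdot)$ denotes spectral radius (which is positive here).
   Formalization: In (H4.2) each θ_b is required to lie in C^m(H̄), i.e. its derivatives of order ≤ m extend continuously to H̄; with θ_b merely C^m on H, Λ_s need not map C^m(H̄) into itself (H=(0,1), m=2, g=1, θ(x)=x^{3/2}/4). *)

theory Defs
  imports "HOL-Analysis.Analysis"
begin

section \<open>The space of \<open>C\<^sup>m\<close> functions up to the closure of an open set\<close>

text \<open>
  A \<open>C\<^sup>m\<close> function on \<open>H\<close> whose derivatives of order at most \<open>m\<close> extend continuously to the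
  closure is identified with its continuous extension, so that its values on \<open>closure H\<close> are
  meaningful. The derivatives themselves are only taken at points of \<open>H\<close>.
\<close>

definition Cm_closure :: "nat \<Rightarrow> real set \<Rightarrow> (real \<Rightarrow> real) \<Rightarrow> bool" where
  "Cm_closure m H w \<longleftrightarrow>
     continuous_on (closure H) w \<and>
     (\<forall>k<m. \<forall>x\<in>H. (deriv ^^ k) w differentiable (at x)) \<and>
     (\<forall>k\<le>m. \<exists>v. continuous_on (closure H) v \<and> (\<forall>x\<in>H. v x = (deriv ^^ k) w x))"

text \<open>
  The vector space \<open>C\<^sup>m\<close> of the closure: every element is represented by exactly one total
  function, namely the one that vanishes off \<open>closure H\<close>.
\<close>

definition Cm_space :: "nat \<Rightarrow> real set \<Rightarrow> (real \<Rightarrow> real) set" where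
  "Cm_space m H = {w. Cm_closure m H w \<and> (\<forall>x. x \<notin> closure H \<longrightarrow> w x = 0)}"

definition Cm_norm :: "nat \<Rightarrow> real set \<Rightarrow> (real \<Rightarrow> real) \<Rightarrow> real" where
  "Cm_norm m H w = (SUP (k, x) \<in> {..m} \<times> H. \<bar>(deriv ^^ k) w x\<bar>)"


section \<open>Spectral radius of an operator on a real normed space of functions\<close>

text \<open>
  A real normed space is given by a linear subspace \<open>V\<close> of the functions from \<open>'a\<close> to the reals,
  with pointwise operations, and a norm \<open>N\<close> on \<open>V\<close>. Its complexification consists of the complex
  functions \<open>u + \<i> v\<close> with \<open>u, v \<in> V\<close>, and an operator \<open>L\<close> acts on it by
  \<open>L (u + \<i> v) = L u + \<i> L v\<close>.
\<close>

definition cplx_space :: "('a \<Rightarrow> real) set \<Rightarrow> ('a \<Rightarrow> complex) set" where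
  "cplx_space V = {f. (\<lambda>x. Re (f x)) \<in> V \<and> (\<lambda>x. Im (f x)) \<in> V}"

definition cplx_op ::
    "(('a \<Rightarrow> real) \<Rightarrow> ('a \<Rightarrow> real)) \<Rightarrow> ('a \<Rightarrow> complex) \<Rightarrow> ('a \<Rightarrow> complex)" where
  "cplx_op L f = (\<lambda>x. Complex (L (\<lambda>y. Re (f y)) x) (L (\<lambda>y. Im (f y)) x))"

text \<open>
  The usual norm of the complexification, the supremum over real \<open>t\<close> of the norms of
  \<open>cos t u - sin t v\<close>.
\<close>

definition cplx_norm :: "(('a \<Rightarrow> real) \<Rightarrow> real) \<Rightarrow> ('a \<Rightarrow> complex) \<Rightarrow> real" where
  "cplx_norm N f = (SUP t::real. N (\<lambda>x. Re (cis t * f x)))"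

text \<open>
  As usual, the spectrum of an operator on a real space is that of its complexification. The
  second conjunct below says that the inverse of \<open>z - L\<close> is bounded.
\<close>

definition resolvent_set ::
    "('a \<Rightarrow> real) set \<Rightarrow> (('a \<Rightarrow> real) \<Rightarrow> real) \<Rightarrow> (('a \<Rightarrow> real) \<Rightarrow> ('a \<Rightarrow> real)) \<Rightarrow> complex set" where
  "resolvent_set V N L =
     {z. bij_betw (\<lambda>f x. z * f x - cplx_op L f x) (cplx_space V) (cplx_space V) \<and>
         (\<exists>C. \<forall>f\<in>cplx_space V. cplx_norm N f \<le> C * cplx_norm N (\<lambda>x. z * f x - cplx_op L f x))}"

definition spectral_radius ::
    "('a \<Rightarrow> real) set \<Rightarrow> (('a \<Rightarrow> real) \<Rightarrow> real) \<Rightarrow> (('a \<Rightarrow> real) \<Rightarrow> ('a \<Rightarrow> real)) \<Rightarrow> real" where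
  "spectral_radius V N L = (SUP z \<in> - resolvent_set V N L. cmod z)"


section \<open>The operators \<open>\<Lambda>\<^sub>s\<close>\<close>

definition Lam ::
    "real set \<Rightarrow> 'b set \<Rightarrow> ('b \<Rightarrow> real \<Rightarrow> real) \<Rightarrow> ('b \<Rightarrow> real \<Rightarrow> real) \<Rightarrow> real
      \<Rightarrow> (real \<Rightarrow> real) \<Rightarrow> (real \<Rightarrow> real)" where
  "Lam H B g \<theta> s w =
     (\<lambda>x. if x \<in> closure H then \<Sum>b\<in>B. (g b x) powr s * w (\<theta> b x) else 0)"

text \<open>For \<open>\<omega> = [j\<^sub>1, \<dots>, j\<^sub>\<mu>]\<close> this is the composition that applies \<open>\<theta> j\<^sub>1\<close> first.\<close>

definition theta_word :: "('b \<Rightarrow> real \<Rightarrow> real) \<Rightarrow> 'b list \<Rightarrow> real \<Rightarrow> real" where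
  "theta_word \<theta> \<omega> x = fold \<theta> \<omega> x"

end

theory Submission
  imports Defs
begin

text \<open>
  Call \<open>c\<close> admissible for \<open>s\<close> if \<open>\<Lambda>\<^sub>s \<eta> \<le> c \<eta>\<close> on \<open>H\<close> for some \<open>\<eta>\<close> bounded above and bounded away
  from \<open>0\<close>. The spectral radius on \<open>C\<^sup>m\<close> is the infimum \<open>r\<close> of the admissible numbers:
  \<^item> If \<open>c\<close> is admissible and \<open>c < \<bar>z\<bar>\<close>, weight the \<open>k\<close>-th derivative by \<open>\<epsilon>\<^sup>k / (\<eta> \<sigma>\<^sup>k)\<close>, where \<open>\<sigma>\<close>
    is a conformal factor for which no \<open>\<theta>\<^sub>b\<close> expands. Since \<open>\<Lambda>\<^sub>s\<close> acts on the vector of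
    derivatives as a triangular matrix whose diagonal entries have weighted norm at most \<open>c\<close>, for
    small \<open>\<epsilon>\<close> its norm is below \<open>\<bar>z\<bar>\<close>, and the Neumann series converges.
  \<^item> If \<open>r - \<Lambda>\<^sub>s\<close> were boundedly invertible, the positive solutions \<open>h\<close> of \<open>c h - \<Lambda>\<^sub>s h = 1\<close> would stay
    below some \<open>M\<close> as \<open>c\<close> decreases to \<open>r\<close>, and \<open>\<Lambda>\<^sub>s h \<le> (c - 1 / M) h\<close> would produce admissible
    numbers below \<open>r\<close>.

  Log-convexity of the infimum is Hoelder's inequality: \<open>\<eta>\<^sub>0\<close>, \<open>c\<^sub>0\<close> and \<open>\<eta>\<^sub>1\<close>, \<open>c\<^sub>1\<close> yield
  \<open>\<eta>\<^sub>0 powr (1 - t) * \<eta>\<^sub>1 powr t\<close> and \<open>c\<^sub>0 powr (1 - t) * c\<^sub>1 powr t\<close>.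
\<close>

section \<open>Calculus of functions of class \<open>C\<^sup>m\<close> up to the boundary\<close>

definition ext_continuous :: "real set \<Rightarrow> (real \<Rightarrow> real) \<Rightarrow> bool" where
  "ext_continuous H u \<longleftrightarrow> (\<exists>v. continuous_on (closure H) v \<and> (\<forall>x\<in>H. v x = u x))"

text \<open>Unlike \<^const>\<open>Cm_closure\<close>, this depends only on the values of the function on \<open>H\<close>.\<close>

fun Cm_ext :: "nat \<Rightarrow> real set \<Rightarrow> (real \<Rightarrow> real) \<Rightarrow> bool" where
  "Cm_ext 0 H w = ext_continuous H w"
| "Cm_ext (Suc m) H w =
     (ext_continuous H w \<and> (\<forall>x\<in>H. w differentiable (at x)) \<and> Cm_ext m H (deriv w))"

text \<open>\<open>Cm_ext\<close> peels off the innermost derivative, so that the sum, product and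
  chain rules go by induction with \<open>deriv w\<close> in place of \<open>w\<close>. This links
  it to the iterated derivatives of \<open>Cm_closure\<close>, which peel off the outermost one; the
  two agree because powers of \<open>deriv\<close> commute.\<close>

lemma Cm_ext_iff:
  "Cm_ext m H w \<longleftrightarrow> (\<forall>k<m. \<forall>x\<in>H. (deriv ^^ k) w differentiable (at x)) \<and>
     (\<forall>k\<le>m. ext_continuous H ((deriv ^^ k) w))"
proof (induction m arbitrary: w)
  case (Suc m)
  have 1: "(\<forall>k<Suc m. \<forall>x\<in>H. (deriv ^^ k) w differentiable (at x)) \<longleftrightarrow>
      (\<forall>x\<in>H. w differentiable (at x)) \<and> (\<forall>k<m. \<forall>x\<in>H. (deriv ^^ k) (deriv w) differentiable (at x))"
    unfolding All_less_Suc2 funpow_Suc_right by simp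
  have "(\<forall>k<Suc (Suc m). ext_continuous H ((deriv ^^ k) w)) \<longleftrightarrow>
      ext_continuous H w \<and> (\<forall>k<Suc m. ext_continuous H ((deriv ^^ k) (deriv w)))"
    unfolding All_less_Suc2[of "Suc m"] funpow_Suc_right by simp
  then have 2: "(\<forall>k\<le>Suc m. ext_continuous H ((deriv ^^ k) w)) \<longleftrightarrow>
      ext_continuous H w \<and> (\<forall>k\<le>m. ext_continuous H ((deriv ^^ k) (deriv w)))"
    unfolding less_Suc_eq_le .
  show ?case unfolding Cm_ext.simps Suc.IH 1 2 by argo
qed simp

lemma Cm_closure_iff: "Cm_closure m H w \<longleftrightarrow> continuous_on (closure H) w \<and> Cm_ext m H w"
  unfolding Cm_closure_def Cm_ext_iff ext_continuous_def by simp

section \<open>Continuity up to the boundary\<close>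

lemma Cm_ext_imp_ext_continuous: "Cm_ext m H w \<Longrightarrow> ext_continuous H w"
  by (cases m) auto

lemma ext_continuous_I: "continuous_on (closure H) w \<Longrightarrow> ext_continuous H w"
  unfolding ext_continuous_def by blast

lemma ext_continuous_cong:
  "(\<And>x. x \<in> H \<Longrightarrow> u x = v x) \<Longrightarrow> ext_continuous H u \<longleftrightarrow> ext_continuous H v"
  unfolding ext_continuous_def by auto

lemma ext_continuous_add:
  assumes "ext_continuous H u" "ext_continuous H v"
  shows "ext_continuous H (\<lambda>x. u x + v x)"
proof -
  obtain u' v' where "continuous_on (closure H) u'" "\<forall>x\<in>H. u' x = u x"
    "continuous_on (closure H) v'" "\<forall>x\<in>H. v' x = v x"
    using assms unfolding ext_continuous_def by blast
  then show ?thesis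
    unfolding ext_continuous_def by (intro exI[of _ "\<lambda>x. u' x + v' x"]) (auto intro!: continuous_intros)
qed

lemma ext_continuous_mult:
  assumes "ext_continuous H u" "ext_continuous H v"
  shows "ext_continuous H (\<lambda>x. u x * v x)"
proof -
  obtain u' v' where "continuous_on (closure H) u'" "\<forall>x\<in>H. u' x = u x"
    "continuous_on (closure H) v'" "\<forall>x\<in>H. v' x = v x"
    using assms unfolding ext_continuous_def by blast
  then show ?thesis
    unfolding ext_continuous_def by (intro exI[of _ "\<lambda>x. u' x * v' x"]) (auto intro!: continuous_intros)
qed

lemma continuous_maps_closure:
  fixes \<theta> :: "real \<Rightarrow> real"
  assumes "continuous_on (closure H) \<theta>" "\<theta> ` H \<subseteq> H"
  shows "\<theta> ` closure H \<subseteq> closure H"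
  by (rule image_closure_subset[OF assms(1)]) (use assms(2) closure_subset in auto)

lemma ext_continuous_compose:
  assumes "ext_continuous H u" "ext_continuous H \<theta>" "\<theta> ` H \<subseteq> H"
  shows "ext_continuous H (\<lambda>x. u (\<theta> x))"
proof -
  obtain u' t where u: "continuous_on (closure H) u'" "\<forall>x\<in>H. u' x = u x"
    and t: "continuous_on (closure H) t" "\<forall>x\<in>H. t x = \<theta> x"
    using assms unfolding ext_continuous_def by blast
  have "t ` closure H \<subseteq> closure H"
    by (rule continuous_maps_closure[OF t(1)]) (use assms(3) t(2) in auto)
  then have "continuous_on (closure H) (\<lambda>x. u' (t x))"
    by (intro continuous_on_compose2[OF u(1) t(1)])
  then show ?thesis
    unfolding ext_continuous_def using u t assms(3) by (intro exI[of _ "\<lambda>x. u' (t x)"]) auto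
qed

lemma ext_continuous_bounded:
  assumes "ext_continuous H u" "bounded H"
  obtains C where "C > 0" "\<And>x. x \<in> H \<Longrightarrow> \<bar>u x\<bar> \<le> C"
proof -
  obtain u' where u: "continuous_on (closure H) u'" "\<forall>x\<in>H. u' x = u x"
    using assms unfolding ext_continuous_def by blast
  have "bounded (u' ` closure H)"
    using u(1) assms(2) by (intro compact_imp_bounded compact_continuous_image) auto
  then obtain C where C: "C > 0" "\<forall>y\<in>u' ` closure H. norm y \<le> C"
    unfolding bounded_pos by blast
  have "\<bar>u x\<bar> \<le> C" if "x \<in> H" for x
  proof -
    have "x \<in> closure H" using that closure_subset by blast
    then have "norm (u' x) \<le> C" using C(2) by blast
    then show ?thesis using u(2) that by simp
  qed
  then show thesis using that C(1) by blast
qed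

section \<open>Derivatives on an open set depend only on the values there\<close>

lemma deriv_cong_open:
  fixes f g :: "real \<Rightarrow> real"
  assumes "open H" "x \<in> H" "\<And>y. y \<in> H \<Longrightarrow> f y = g y"
  shows "deriv f x = deriv g x"
proof (rule deriv_cong_ev)
  show "\<forall>\<^sub>F y in nhds x. f y = g y"
    unfolding eventually_nhds using assms by blast
qed simp

lemma differentiable_cong_open:
  fixes f g :: "real \<Rightarrow> real"
  assumes "open H" "x \<in> H" "\<And>y. y \<in> H \<Longrightarrow> f y = g y" "f differentiable (at x)"
  shows "g differentiable (at x)"
proof -
  obtain D where "(f has_derivative D) (at x)" using assms(4) unfolding differentiable_def ..
  then have "(g has_derivative D) (at x)"
    by (rule has_derivative_transform_within_open[OF _ assms(1,2)]) (rule assms(3))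
  then show ?thesis by (rule differentiableI)
qed

lemma funpow_deriv_cong_open:
  fixes f g :: "real \<Rightarrow> real"
  assumes "open H" "x \<in> H" "\<And>y. y \<in> H \<Longrightarrow> f y = g y"
  shows "(deriv ^^ k) f x = (deriv ^^ k) g x"
  using assms(2)
proof (induction k arbitrary: x)
  case (Suc k)
  then show ?case using deriv_cong_open[OF assms(1) Suc.prems, of "(deriv ^^ k) f" "(deriv ^^ k) g"] by simp
qed (use assms in auto)

lemma Cm_ext_cong:
  assumes "open H" "\<And>x. x \<in> H \<Longrightarrow> f x = g x" "Cm_ext m H f"
  shows "Cm_ext m H g"
  using assms(2,3)
proof (induction m arbitrary: f g)
  case 0
  then show ?case using ext_continuous_cong[of H f g] by simp
next
  case (Suc m)
  have "ext_continuous H g" using Suc.prems ext_continuous_cong[of H f g] by simp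
  moreover have "g differentiable (at x)" if "x \<in> H" for x
    using Suc.prems that by (intro differentiable_cong_open[OF assms(1), of x f g]) auto
  moreover have "Cm_ext m H (deriv g)"
    by (rule Suc.IH[of "deriv f"]) (use Suc.prems deriv_cong_open[OF assms(1), of _ f g] in auto)
  ultimately show ?case by simp
qed

section \<open>Closure properties of the class \<open>Cm_ext\<close>\<close>

lemma Cm_ext_mono: "Cm_ext m H w \<Longrightarrow> k \<le> m \<Longrightarrow> Cm_ext k H w"
  unfolding Cm_ext_iff by auto

lemma Cm_ext_SucD: "Cm_ext (Suc m) H w \<Longrightarrow> Cm_ext m H w"
  by (erule Cm_ext_mono) simp

lemma has_deriv_Cm_ext:
  "Cm_ext (Suc m) H w \<Longrightarrow> x \<in> H \<Longrightarrow> (w has_field_derivative deriv w x) (at x)"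
  by (simp add: DERIV_deriv_iff_real_differentiable)

lemma Cm_ext_const: "Cm_ext m H (\<lambda>x. c)"
  by (induction m arbitrary: c) (auto intro!: ext_continuous_I)

text \<open>The formula for the derivative holds on \<open>H\<close> only, while
  \<open>deriv\<close> of the sum is a total function. \<open>Cm_ext_cong\<close> bridges this gap,
  here and in the product, chain and power rules.\<close>

lemma Cm_ext_add:
  assumes "open H"
  shows "Cm_ext m H u \<Longrightarrow> Cm_ext m H v \<Longrightarrow> Cm_ext m H (\<lambda>x. u x + v x)"
proof (induction m arbitrary: u v)
  case (Suc m)
  have *: "Cm_ext m H (\<lambda>x. deriv u x + deriv v x)" using Suc by simp
  have d: "((\<lambda>x. u x + v x) has_field_derivative deriv u x + deriv v x) (at x)" if "x \<in> H" for x
    using has_deriv_Cm_ext[OF Suc.prems(1) that] has_deriv_Cm_ext[OF Suc.prems(2) that]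
    by (rule DERIV_add)
  have "Cm_ext m H (deriv (\<lambda>x. u x + v x))"
    by (rule Cm_ext_cong[OF assms _ *]) (simp add: DERIV_imp_deriv[OF d])
  then show ?case using Suc.prems d
    by (auto simp: ext_continuous_add real_differentiable_def)
qed (simp add: ext_continuous_add)

lemma Cm_ext_mult:
  assumes "open H"
  shows "Cm_ext m H u \<Longrightarrow> Cm_ext m H v \<Longrightarrow> Cm_ext m H (\<lambda>x. u x * v x)"
proof (induction m arbitrary: u v)
  case (Suc m)
  have *: "Cm_ext m H (\<lambda>x. deriv u x * v x + deriv v x * u x)"
    using Suc.prems Suc.prems[THEN Cm_ext_SucD] by (intro Cm_ext_add[OF assms] Suc.IH) auto
  have d: "((\<lambda>x. u x * v x) has_field_derivative deriv u x * v x + deriv v x * u x) (at x)"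
    if "x \<in> H" for x
    using has_deriv_Cm_ext[OF Suc.prems(1) that] has_deriv_Cm_ext[OF Suc.prems(2) that]
    by (rule DERIV_mult)
  have "Cm_ext m H (deriv (\<lambda>x. u x * v x))"
    by (rule Cm_ext_cong[OF assms _ *]) (simp add: DERIV_imp_deriv[OF d])
  then show ?case using Suc.prems d
    by (auto simp: ext_continuous_mult real_differentiable_def)
qed (simp add: ext_continuous_mult)

lemma Cm_ext_sum:
  assumes "open H" "finite B" "\<And>b. b \<in> B \<Longrightarrow> Cm_ext m H (f b)"
  shows "Cm_ext m H (\<lambda>x. \<Sum>b\<in>B. f b x)"
  using assms(2,3)
  by (induction B) (auto simp: Cm_ext_const Cm_ext_add[OF assms(1)])

lemma Cm_ext_compose:
  assumes "open H" "\<theta> ` H \<subseteq> H"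
  shows "Cm_ext m H w \<Longrightarrow> Cm_ext m H \<theta> \<Longrightarrow> Cm_ext m H (\<lambda>x. w (\<theta> x))"
proof (induction m arbitrary: w)
  case (Suc m)
  have *: "Cm_ext m H (\<lambda>x. deriv w (\<theta> x) * deriv \<theta> x)"
    using Suc.prems by (intro Cm_ext_mult[OF assms(1)] Suc.IH[of "deriv w"] Cm_ext_SucD[OF Suc.prems(2)]) auto
  have d: "((\<lambda>x. w (\<theta> x)) has_field_derivative deriv w (\<theta> x) * deriv \<theta> x) (at x)"
    if "x \<in> H" for x
    using that assms(2)
    by (intro DERIV_chain2[OF has_deriv_Cm_ext[OF Suc.prems(1)] has_deriv_Cm_ext[OF Suc.prems(2)]]) auto
  have "Cm_ext m H (deriv (\<lambda>x. w (\<theta> x)))"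
    by (rule Cm_ext_cong[OF assms(1) _ *]) (simp add: DERIV_imp_deriv[OF d])
  then show ?case using Suc.prems d assms
    by (auto simp: ext_continuous_compose real_differentiable_def)
qed (simp add: ext_continuous_compose assms)

text \<open>Each differentiation lowers the exponent by one, hence the induction for arbitrary
  \<open>s\<close>. Positivity on the closure, and not just on \<open>H\<close>, keeps negative
  powers continuous up to the boundary.\<close>

lemma Cm_ext_powr:
  assumes "open H" "continuous_on (closure H) g" "\<And>x. x \<in> closure H \<Longrightarrow> g x > 0"
  shows "Cm_ext m H g \<Longrightarrow> Cm_ext m H (\<lambda>x. g x powr s)"
proof (induction m arbitrary: s)
  case 0
  show ?case unfolding Cm_ext.simps
    using assms(2,3) by (intro ext_continuous_I continuous_on_powr continuous_on_const) (auto simp: less_le)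
next
  case (Suc m)
  have pos: "g x > 0" if "x \<in> H" for x using assms(3) that closure_subset[of H] by auto
  have ext: "ext_continuous H (\<lambda>x. g x powr s)"
    using assms(2,3) by (intro ext_continuous_I continuous_on_powr continuous_on_const) (auto simp: less_le)
  have *: "Cm_ext m H (\<lambda>x. s * g x powr (s - 1) * deriv g x)"
    using Suc.prems Suc.prems[THEN Cm_ext_SucD] by (intro Cm_ext_mult[OF assms(1)] Cm_ext_const Suc.IH) auto
  have d: "((\<lambda>x. g x powr s) has_field_derivative s * g x powr (s - 1) * deriv g x) (at x)"
    if "x \<in> H" for x
    using DERIV_fun_powr[OF has_deriv_Cm_ext[OF Suc.prems that] pos[OF that], of s] by simp
  have "Cm_ext m H (deriv (\<lambda>x. g x powr s))"
    by (rule Cm_ext_cong[OF assms(1) _ *]) (simp add: DERIV_imp_deriv[OF d])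
  then show ?case using d ext by (auto simp: real_differentiable_def)
qed

section \<open>Linearity of iterated derivatives\<close>

lemma funpow_deriv_linear:
  assumes "open H"
  shows "Cm_ext m H u \<Longrightarrow> Cm_ext m H v \<Longrightarrow> k \<le> m \<Longrightarrow> x \<in> H \<Longrightarrow>
    (deriv ^^ k) (\<lambda>x. a * u x + b * v x) x = a * (deriv ^^ k) u x + b * (deriv ^^ k) v x"
proof (induction k arbitrary: m u v)
  case (Suc k)
  then obtain n where m: "m = Suc n" by (cases m) auto
  have *: "deriv (\<lambda>x. a * u x + b * v x) y = a * deriv u y + b * deriv v y" if "y \<in> H" for y
    using has_deriv_Cm_ext[of n H u] has_deriv_Cm_ext[of n H v] Suc.prems that unfolding m
    by (intro DERIV_imp_deriv) (auto intro!: derivative_eq_intros)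
  have "(deriv ^^ Suc k) (\<lambda>x. a * u x + b * v x) x = (deriv ^^ k) (deriv (\<lambda>x. a * u x + b * v x)) x"
    by (simp add: funpow_swap1)
  also have "\<dots> = (deriv ^^ k) (\<lambda>x. a * deriv u x + b * deriv v x) x"
    by (rule funpow_deriv_cong_open[OF assms Suc.prems(4) *])
  also have "\<dots> = a * (deriv ^^ k) (deriv u) x + b * (deriv ^^ k) (deriv v) x"
    using Suc.prems m by (intro Suc.IH[of n]) auto
  finally show ?case by (simp add: funpow_swap1)
qed auto

lemma funpow_deriv_sum:
  assumes "open H" "finite B" "\<And>b. b \<in> B \<Longrightarrow> Cm_ext m H (f b)" "k \<le> m" "x \<in> H"
  shows "(deriv ^^ k) (\<lambda>x. \<Sum>b\<in>B. f b x) x = (\<Sum>b\<in>B. (deriv ^^ k) (f b) x)"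
  using assms(2,3)
proof (induction B)
  case empty
  have "(deriv ^^ k) (\<lambda>x. 0 * (0::real) + 0 * 0) x = 0 * (deriv ^^ k) (\<lambda>x. 0) x + 0 * (deriv ^^ k) (\<lambda>x. 0) x"
    by (rule funpow_deriv_linear[OF assms(1) Cm_ext_const Cm_ext_const assms(4,5)])
  then show ?case by simp
next
  case (insert b B)
  have "(deriv ^^ k) (\<lambda>x. 1 * f b x + 1 * (\<Sum>b\<in>B. f b x)) x =
      1 * (deriv ^^ k) (f b) x + 1 * (deriv ^^ k) (\<lambda>x. \<Sum>b\<in>B. f b x) x"
    using insert.prems insert.hyps
    by (intro funpow_deriv_linear[OF assms(1) _ _ assms(4,5)] Cm_ext_sum[OF assms(1)]) auto
  then show ?case using insert by simp
qed

section \<open>Complexification of a seminormed space of functions\<close>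

text \<open>Serves both for \<open>Cm_norm\<close> and for the weighted norm of
  \<open>resolvent_of_admissible\<close>. Definiteness and completeness are left out;
  \<open>resolvent_set_memI\<close> asks for them in one of the two equivalent norms.\<close>

locale seminormed_functions =
  fixes V :: "('a \<Rightarrow> real) set" and N :: "('a \<Rightarrow> real) \<Rightarrow> real"
  assumes zero_mem: "(\<lambda>x. 0) \<in> V"
    and lincomb_mem: "\<And>u v a b. u \<in> V \<Longrightarrow> v \<in> V \<Longrightarrow> (\<lambda>x. a * u x + b * v x) \<in> V"
    and N_add: "\<And>u v. u \<in> V \<Longrightarrow> v \<in> V \<Longrightarrow> N (\<lambda>x. u x + v x) \<le> N u + N v"
    and N_scale: "\<And>u a. u \<in> V \<Longrightarrow> N (\<lambda>x. a * u x) = \<bar>a\<bar> * N u"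
begin

lemma scale_mem: "u \<in> V \<Longrightarrow> (\<lambda>x. a * u x) \<in> V"
  using lincomb_mem[of u u a 0] by simp

lemma diff_mem: "u \<in> V \<Longrightarrow> v \<in> V \<Longrightarrow> (\<lambda>x. u x - v x) \<in> V"
  using lincomb_mem[of u v 1 "-1"] by simp

lemma N_zero: "N (\<lambda>x. 0) = 0"
  using N_scale[OF zero_mem, of 0] by simp

lemma N_nonneg: "u \<in> V \<Longrightarrow> 0 \<le> N u"
  using N_add[of u "\<lambda>x. -1 * u x"] N_scale[of u "-1"] scale_mem[of u "-1"] N_zero by simp

lemma N_lincomb_le:
  assumes "u \<in> V" "v \<in> V"
  shows "N (\<lambda>x. a * u x + b * v x) \<le> \<bar>a\<bar> * N u + \<bar>b\<bar> * N v"
  using N_add[OF scale_mem[OF assms(1), of a] scale_mem[OF assms(2), of b]] N_scale assms by simp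

lemma cplx_spaceD: "f \<in> cplx_space V \<Longrightarrow> (\<lambda>x. Re (f x)) \<in> V" "f \<in> cplx_space V \<Longrightarrow> (\<lambda>x. Im (f x)) \<in> V"
  by (auto simp: cplx_space_def)

lemma cplx_lincomb_mem:
  assumes "f \<in> cplx_space V" "h \<in> cplx_space V"
  shows "(\<lambda>x. a * f x + b * h x) \<in> cplx_space V"
proof -
  show ?thesis
    using lincomb_mem[OF lincomb_mem[OF cplx_spaceD[OF assms(1)], of "Re a" "- Im a"]
        lincomb_mem[OF cplx_spaceD[OF assms(2)], of "Re b" "- Im b"], of 1 1]
      lincomb_mem[OF lincomb_mem[OF cplx_spaceD[OF assms(1)], of "Im a" "Re a"]
        lincomb_mem[OF cplx_spaceD[OF assms(2)], of "Im b" "Re b"], of 1 1]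
    by (simp add: cplx_space_def algebra_simps)
qed

lemma cplx_scale_mem: "f \<in> cplx_space V \<Longrightarrow> (\<lambda>x. a * f x) \<in> cplx_space V"
  using cplx_lincomb_mem[of f f a 0] by simp

lemma cplx_diff_mem: "f \<in> cplx_space V \<Longrightarrow> h \<in> cplx_space V \<Longrightarrow> (\<lambda>x. f x - h x) \<in> cplx_space V"
  using cplx_lincomb_mem[of f h 1 "-1"] by simp

lemma rotate_mem: "f \<in> cplx_space V \<Longrightarrow> (\<lambda>x. Re (cis t * f x)) \<in> V"
  using cplx_spaceD(1)[OF cplx_scale_mem] .

text \<open>The bound is uniform in the angle, so the supremum that defines \<open>cplx_norm\<close>
  is taken over a bounded set.\<close>

lemma N_rotate_le:
  assumes "f \<in> cplx_space V"
  shows "N (\<lambda>x. Re (cis t * f x)) \<le> N (\<lambda>x. Re (f x)) + N (\<lambda>x. Im (f x))"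
proof -
  have "N (\<lambda>x. Re (cis t * f x)) \<le> \<bar>cos t\<bar> * N (\<lambda>x. Re (f x)) + \<bar>- sin t\<bar> * N (\<lambda>x. Im (f x))"
    using N_lincomb_le[OF cplx_spaceD[OF assms], of "cos t" "- sin t"] by simp
  also have "\<dots> \<le> 1 * N (\<lambda>x. Re (f x)) + 1 * N (\<lambda>x. Im (f x))"
    using N_nonneg[OF cplx_spaceD(1)[OF assms]] N_nonneg[OF cplx_spaceD(2)[OF assms]]
    by (intro add_mono mult_right_mono) auto
  finally show ?thesis by simp
qed

lemma cplx_norm_least: "(\<And>t. N (\<lambda>x. Re (cis t * f x)) \<le> c) \<Longrightarrow> cplx_norm N f \<le> c"
  unfolding cplx_norm_def by (rule cSUP_least) auto

lemma cplx_norm_upper: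
  assumes "f \<in> cplx_space V"
  shows "N (\<lambda>x. Re (cis t * f x)) \<le> cplx_norm N f"
  unfolding cplx_norm_def
  by (rule cSUP_upper2[OF bdd_aboveI2[OF N_rotate_le[OF assms]] UNIV_I order_refl])

lemma cplx_norm_le_Re_Im:
  "f \<in> cplx_space V \<Longrightarrow> cplx_norm N f \<le> N (\<lambda>x. Re (f x)) + N (\<lambda>x. Im (f x))"
  by (rule cplx_norm_least) (rule N_rotate_le)

lemma Re_le_cplx_norm: "f \<in> cplx_space V \<Longrightarrow> N (\<lambda>x. Re (f x)) \<le> cplx_norm N f"
  using cplx_norm_upper[of f 0] by simp

lemma Im_le_cplx_norm: "f \<in> cplx_space V \<Longrightarrow> N (\<lambda>x. Im (f x)) \<le> cplx_norm N f"
  \<comment> \<open>\<open>cis (- (pi / 2))\<close> is minus the imaginary unit, and multiplication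
    by it moves the imaginary part to the real part.\<close>
  using cplx_norm_upper[of f "- (pi / 2)"] by simp

lemma cplx_norm_nonneg: "f \<in> cplx_space V \<Longrightarrow> 0 \<le> cplx_norm N f"
  using Re_le_cplx_norm[of f] N_nonneg[OF cplx_spaceD(1)[of f]] by simp

lemma cplx_norm_add:
  assumes "f \<in> cplx_space V" "h \<in> cplx_space V"
  shows "cplx_norm N (\<lambda>x. f x + h x) \<le> cplx_norm N f + cplx_norm N h"
proof (rule cplx_norm_least)
  fix t
  have "N (\<lambda>x. Re (cis t * (f x + h x))) = N (\<lambda>x. Re (cis t * f x) + Re (cis t * h x))"
    by (simp add: algebra_simps)
  also have "\<dots> \<le> cplx_norm N f + cplx_norm N h"
    by (rule order_trans[OF N_add[OF rotate_mem[OF assms(1)] rotate_mem[OF assms(2)]]])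
      (intro add_mono cplx_norm_upper assms)
  finally show "N (\<lambda>x. Re (cis t * (f x + h x))) \<le> cplx_norm N f + cplx_norm N h" .
qed

text \<open>In polar form \<open>z\<close> scales by \<open>cmod z\<close> and shifts the angle of
  rotation by its argument, which only reparametrizes the supremum. The opposite shift gives the
  reverse inequality.\<close>

lemma cplx_norm_scale:
  assumes "f \<in> cplx_space V"
  shows "cplx_norm N (\<lambda>x. z * f x) = cmod z * cplx_norm N f"
proof -
  obtain a where a: "z = cmod z * cis a"
    by (metis rcis_cmod_Arg rcis_def)
  have rot: "N (\<lambda>x. Re (cis t * (z * f x))) = cmod z * N (\<lambda>x. Re (cis (t + a) * f x))" for t
  proof -
    have "cis t * (z * f x) = cmod z * (cis (t + a) * f x)" for x
      by (subst a) (simp add: cis_mult[symmetric])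
    then have "Re (cis t * (z * f x)) = cmod z * Re (cis (t + a) * f x)" for x
      by (simp only: scaleR_conv_of_real[symmetric] scaleR_complex.sel)
    then show ?thesis using N_scale[OF rotate_mem[OF assms], of "cmod z" "t + a"] by simp
  qed
  have "cplx_norm N (\<lambda>x. z * f x) \<le> cmod z * cplx_norm N f"
    by (rule cplx_norm_least) (auto simp only: rot intro!: mult_left_mono cplx_norm_upper assms norm_ge_zero)
  moreover have "cmod z * cplx_norm N f \<le> cplx_norm N (\<lambda>x. z * f x)"
  proof (cases "z = 0")
    case True
    then show ?thesis using cplx_norm_nonneg[OF cplx_scale_mem[OF assms, of 0]] by simp
  next
    case False
    have "cplx_norm N f \<le> cplx_norm N (\<lambda>x. z * f x) / cmod z"
    proof (rule cplx_norm_least)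
      fix t
      have "cmod z * N (\<lambda>x. Re (cis t * f x)) \<le> cplx_norm N (\<lambda>x. z * f x)"
        using rot[of "t - a"] cplx_norm_upper[OF cplx_scale_mem[OF assms], of "t - a" z] by simp
      then show "N (\<lambda>x. Re (cis t * f x)) \<le> cplx_norm N (\<lambda>x. z * f x) / cmod z"
        using False by (simp add: field_simps)
    qed
    then show ?thesis using False by (simp add: field_simps)
  qed
  ultimately show ?thesis by simp
qed

end

text \<open>A one-sided bound for multiples suffices: applied to the factor \<open>1 / a\<close> it
  yields the reverse inequality, and for the factor 0 nonnegativity closes the gap.\<close>

lemma seminormed_functionsI:
  assumes "(\<lambda>x. 0) \<in> V" and "\<And>u v a b. u \<in> V \<Longrightarrow> v \<in> V \<Longrightarrow> (\<lambda>x. a * u x + b * v x) \<in> V"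
    and "\<And>u v. u \<in> V \<Longrightarrow> v \<in> V \<Longrightarrow> N (\<lambda>x. u x + v x) \<le> N u + N v"
    and le: "\<And>u a. u \<in> V \<Longrightarrow> N (\<lambda>x. a * u x) \<le> \<bar>a\<bar> * N u"
    and nonneg: "\<And>u. u \<in> V \<Longrightarrow> 0 \<le> N u"
  shows "seminormed_functions V N"
proof
  fix u and a :: real assume u: "u \<in> V"
  show "N (\<lambda>x. a * u x) = \<bar>a\<bar> * N u"
  proof (cases "a = 0")
    case True
    then show ?thesis using le[OF u, of 0] nonneg[OF assms(1)] by simp
  next
    case False
    have "(\<lambda>x. a * u x) \<in> V" using assms(2)[OF u u, of a 0] by simp
    from le[OF this, of "1 / a"] have "\<bar>a\<bar> * N u \<le> N (\<lambda>x. a * u x)"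
      using False by (simp add: field_simps)
    then show ?thesis using le[OF u, of a] by simp
  qed
qed (use assms in auto)

lemma cplx_norm_mono:
  assumes "seminormed_functions V N" "seminormed_functions V M" "c \<ge> 0"
    and "\<And>u. u \<in> V \<Longrightarrow> N u \<le> c * M u" and "f \<in> cplx_space V"
  shows "cplx_norm N f \<le> c * cplx_norm M f"
proof (rule seminormed_functions.cplx_norm_least[OF assms(1)])
  fix t
  show "N (\<lambda>x. Re (cis t * f x)) \<le> c * cplx_norm M f"
    using assms(4)[OF seminormed_functions.rotate_mem[OF assms(1,5)], of t]
      mult_left_mono[OF seminormed_functions.cplx_norm_upper[OF assms(2,5), of t] assms(3)] by linarith
qed

text \<open>Neumann series in the equivalent norm \<open>M\<close>, for which \<open>L / z\<close> is a strict contraction.\<close>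

lemma resolvent_set_memI:
  fixes V :: "('a \<Rightarrow> real) set"
  assumes N: "seminormed_functions V N" and M: "seminormed_functions V M"
    and MN: "C1 \<ge> 0" "\<And>u. u \<in> V \<Longrightarrow> M u \<le> C1 * N u"
    and NM: "C2 \<ge> 0" "\<And>u. u \<in> V \<Longrightarrow> N u \<le> C2 * M u"
    and definite: "\<And>u. u \<in> V \<Longrightarrow> N u = 0 \<Longrightarrow> u = (\<lambda>x. 0)"
    and complete: "\<And>u A q. (\<And>n. u n \<in> V) \<Longrightarrow> 0 \<le> q \<Longrightarrow> q < 1 \<Longrightarrow>
        (\<And>n. N (\<lambda>x. u (Suc n) x - u n x) \<le> A * q ^ n) \<Longrightarrow>
        \<exists>l\<in>V. (\<lambda>n. N (\<lambda>x. u n x - l x)) \<longlonglongrightarrow> 0"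
    and L_mem: "\<And>u. u \<in> V \<Longrightarrow> L u \<in> V"
    and L_linear: "\<And>u v a b x. u \<in> V \<Longrightarrow> v \<in> V \<Longrightarrow>
        L (\<lambda>x. a * u x + b * v x) x = a * L u x + b * L v x"
    and L_bound: "\<And>u. u \<in> V \<Longrightarrow> M (L u) \<le> q * M u"
    and q: "0 \<le> q" "q < cmod z"
  shows "z \<in> resolvent_set V N L"
proof -
  interpret N: seminormed_functions V N by fact
  interpret M: seminormed_functions V M by fact
  define K where "K = cplx_op L"
  define T where "T f = (\<lambda>x. z * f x - K f x)" for f
  have z0: "z \<noteq> 0" "cmod z > 0" using q by auto
  have Re_K: "Re (K f x) = L (\<lambda>y. Re (f y)) x" and Im_K: "Im (K f x) = L (\<lambda>y. Im (f y)) x" for f x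
    by (simp_all add: K_def cplx_op_def)
  have K_mem: "K f \<in> cplx_space V" if "f \<in> cplx_space V" for f
    using that L_mem by (simp add: cplx_space_def Re_K Im_K)
  have T_mem: "T f \<in> cplx_space V" if "f \<in> cplx_space V" for f
    unfolding T_def using that by (intro N.cplx_diff_mem N.cplx_scale_mem K_mem)
  have K_diff: "K (\<lambda>x. f x - h x) x = K f x - K h x" if "f \<in> cplx_space V" "h \<in> cplx_space V" for f h x
    using L_linear[OF N.cplx_spaceD(1)[OF that(1)] N.cplx_spaceD(1)[OF that(2)], of 1 "-1"]
      L_linear[OF N.cplx_spaceD(2)[OF that(1)] N.cplx_spaceD(2)[OF that(2)], of 1 "-1"]
    by (simp add: complex_eq_iff Re_K Im_K)
  have T_diff: "T (\<lambda>x. f x - h x) = (\<lambda>x. T f x - T h x)" if "f \<in> cplx_space V" "h \<in> cplx_space V" for f h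
    using K_diff[OF that] by (simp add: T_def fun_eq_iff algebra_simps)
  have K_bound: "cplx_norm M (K f) \<le> q * cplx_norm M f" if f: "f \<in> cplx_space V" for f
  proof (rule M.cplx_norm_least)
    fix t
    have "L (\<lambda>x. Re (cis t * f x)) = (\<lambda>x. Re (cis t * K f x))"
      using L_linear[OF N.cplx_spaceD[OF f], of "cos t" "- sin t"] by (simp add: fun_eq_iff Re_K Im_K)
    then have "M (\<lambda>x. Re (cis t * K f x)) \<le> q * M (\<lambda>x. Re (cis t * f x))"
      using L_bound[OF N.rotate_mem[OF f, of t]] by simp
    also have "\<dots> \<le> q * cplx_norm M f" by (intro mult_left_mono M.cplx_norm_upper f q)
    finally show "M (\<lambda>x. Re (cis t * K f x)) \<le> q * cplx_norm M f" .
  qed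
  \<comment> \<open>The reverse triangle inequality; it gives both the injectivity of
    \<open>T\<close> and the bound on its inverse.\<close>
  have T_lower: "(cmod z - q) * cplx_norm M f \<le> cplx_norm M (T f)" if f: "f \<in> cplx_space V" for f
  proof -
    have "cmod z * cplx_norm M f = cplx_norm M (\<lambda>x. T f x + K f x)"
      using M.cplx_norm_scale[OF f, of z] by (simp add: T_def)
    also have "\<dots> \<le> cplx_norm M (T f) + q * cplx_norm M f"
      using M.cplx_norm_add[OF T_mem[OF f] K_mem[OF f]] K_bound[OF f] by simp
    finally show ?thesis by (simp add: algebra_simps)
  qed
  have T_upper: "cplx_norm M (T f) \<le> (cmod z + q) * cplx_norm M f" if f: "f \<in> cplx_space V" for f
  proof -
    have "cplx_norm M (T f) = cplx_norm M (\<lambda>x. z * f x + (-1) * K f x)"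
      by (simp add: T_def)
    also have "\<dots> \<le> cplx_norm M (\<lambda>x. z * f x) + cplx_norm M (\<lambda>x. (-1) * K f x)"
      by (intro M.cplx_norm_add N.cplx_scale_mem f K_mem)
    also have "\<dots> \<le> cmod z * cplx_norm M f + q * cplx_norm M f"
      using K_bound[OF f] by (simp only: M.cplx_norm_scale[OF f] M.cplx_norm_scale[OF K_mem[OF f]]) simp
    finally show ?thesis by (simp add: algebra_simps)
  qed
  have null: "f = (\<lambda>x. 0)" if f: "f \<in> cplx_space V" and "cplx_norm M f \<le> 0" for f
  proof -
    have "cplx_norm N f \<le> C2 * cplx_norm M f" by (rule cplx_norm_mono[OF N M NM f])
    also have "\<dots> \<le> 0" using NM that by (simp add: mult_nonneg_nonpos)
    finally have "cplx_norm N f \<le> 0" .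
    then have "N (\<lambda>x. Re (f x)) = 0" "N (\<lambda>x. Im (f x)) = 0"
      using N.Re_le_cplx_norm[OF f] N.Im_le_cplx_norm[OF f] N.N_nonneg[OF N.cplx_spaceD(1)[OF f]]
        N.N_nonneg[OF N.cplx_spaceD(2)[OF f]] by auto
    then have "(\<lambda>x. Re (f x)) = (\<lambda>x. 0)" "(\<lambda>x. Im (f x)) = (\<lambda>x. 0)"
      using definite[OF N.cplx_spaceD(1)[OF f]] definite[OF N.cplx_spaceD(2)[OF f]] by simp_all
    then show ?thesis by (simp add: fun_eq_iff complex_eq_iff)
  qed
  have "inj_on T (cplx_space V)"
  proof (rule inj_onI)
    fix f h assume fh: "f \<in> cplx_space V" "h \<in> cplx_space V" "T f = T h"
    let ?d = "\<lambda>x. f x - h x"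
    have d: "?d \<in> cplx_space V" by (rule N.cplx_diff_mem[OF fh(1,2)])
    have "T ?d = (\<lambda>x. 0)" using T_diff[OF fh(1,2)] fh(3) by simp
    then have "(cmod z - q) * cplx_norm M ?d \<le> cplx_norm M (\<lambda>x. 0)"
      using T_lower[OF d] by simp
    also have "\<dots> = 0" by (simp add: cplx_norm_def M.N_zero)
    finally have "cplx_norm M ?d \<le> 0" using q by (simp add: mult_le_0_iff)
    then have "?d = (\<lambda>x. 0)" by (rule null[OF d])
    then show "f = h" by (simp add: fun_eq_iff)
  qed
  moreover have "h \<in> T ` cplx_space V" if h: "h \<in> cplx_space V" for h
  proof -
    \<comment> \<open>Fixed-point iteration for \<open>f = (h + K f) / z\<close>, started at 0: the
      iterates are the partial sums of the Neumann series.\<close>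
    define u where "u = rec_nat (\<lambda>x. 0) (\<lambda>_ f x. (h x + K f x) / z)"
    have u_Suc: "u (Suc n) = (\<lambda>x. (h x + K (u n) x) / z)" for n by (simp add: u_def)
    have u_mem: "u n \<in> cplx_space V" for n
    proof (induction n)
      case 0
      then show ?case using N.zero_mem by (simp add: u_def cplx_space_def)
    next
      case (Suc n)
      show ?case unfolding u_Suc
        using N.cplx_lincomb_mem[OF h K_mem[OF Suc], of "1 / z" "1 / z"] by (simp add: add_divide_distrib)
    qed
    define d where "d n = (\<lambda>x. u (Suc n) x - u n x)" for n
    have d_mem: "d n \<in> cplx_space V" for n unfolding d_def by (intro N.cplx_diff_mem u_mem)
    define p where "p = q / cmod z"
    have p: "0 \<le> p" "p < 1" using q z0 by (auto simp: p_def)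
    have d_bound: "cplx_norm M (d n) \<le> cplx_norm M (d 0) * p ^ n" for n
    proof (induction n)
      case (Suc n)
      have "d (Suc n) = (\<lambda>x. (1 / z) * K (d n) x)"
        unfolding d_def K_diff[OF u_mem u_mem, of "Suc n" n] by (simp add: u_Suc diff_divide_distrib add_divide_distrib)
      then have "cplx_norm M (d (Suc n)) = cmod (1 / z) * cplx_norm M (K (d n))"
        by (simp only: M.cplx_norm_scale[OF K_mem[OF d_mem]])
      also have "\<dots> \<le> cmod (1 / z) * (q * cplx_norm M (d n))"
        by (intro mult_left_mono K_bound d_mem) auto
      also have "\<dots> = p * cplx_norm M (d n)" by (simp add: p_def norm_divide)
      also have "\<dots> \<le> p * (cplx_norm M (d 0) * p ^ n)" by (intro mult_left_mono Suc p)
      finally show ?case by (simp add: algebra_simps)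
    qed simp
    have dN: "cplx_norm N (d n) \<le> C2 * cplx_norm M (d 0) * p ^ n" for n
      using cplx_norm_mono[OF N M NM d_mem[of n]] mult_left_mono[OF d_bound[of n] NM(1)] by (simp add: mult.assoc)
    \<comment> \<open>Completeness is assumed for the real space only, so the real and imaginary
      parts are passed to the limit separately.\<close>
    have "\<exists>l\<in>V. (\<lambda>n. N (\<lambda>x. Re (u n x) - l x)) \<longlonglongrightarrow> 0"
    proof (rule complete[OF _ p])
      show "(\<lambda>x. Re (u n x)) \<in> V" for n by (rule N.cplx_spaceD(1)[OF u_mem])
      show "N (\<lambda>x. Re (u (Suc n) x) - Re (u n x)) \<le> C2 * cplx_norm M (d 0) * p ^ n" for n
        using N.Re_le_cplx_norm[OF d_mem[of n]] dN[of n] by (simp add: d_def)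
    qed
    then obtain a where a: "a \<in> V" "(\<lambda>n. N (\<lambda>x. Re (u n x) - a x)) \<longlonglongrightarrow> 0" by blast
    have "\<exists>l\<in>V. (\<lambda>n. N (\<lambda>x. Im (u n x) - l x)) \<longlonglongrightarrow> 0"
    proof (rule complete[OF _ p])
      show "(\<lambda>x. Im (u n x)) \<in> V" for n by (rule N.cplx_spaceD(2)[OF u_mem])
      show "N (\<lambda>x. Im (u (Suc n) x) - Im (u n x)) \<le> C2 * cplx_norm M (d 0) * p ^ n" for n
        using N.Im_le_cplx_norm[OF d_mem[of n]] dN[of n] by (simp add: d_def)
    qed
    then obtain b where b: "b \<in> V" "(\<lambda>n. N (\<lambda>x. Im (u n x) - b x)) \<longlonglongrightarrow> 0" by blast
    define f where "f x = Complex (a x) (b x)" for x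
    have f: "f \<in> cplx_space V" using a b by (simp add: cplx_space_def f_def)
    define e where "e n = C1 * (N (\<lambda>x. Re (u n x) - a x) + N (\<lambda>x. Im (u n x) - b x))" for n
    have uf: "(\<lambda>x. u n x - f x) \<in> cplx_space V" for n by (intro N.cplx_diff_mem f u_mem)
    have e: "cplx_norm M (\<lambda>x. u n x - f x) \<le> e n" for n
    proof -
      have "cplx_norm N (\<lambda>x. u n x - f x) \<le> N (\<lambda>x. Re (u n x) - a x) + N (\<lambda>x. Im (u n x) - b x)"
        using N.cplx_norm_le_Re_Im[OF uf[of n]] by (simp add: f_def)
      then show ?thesis
        using cplx_norm_mono[OF M N MN uf[of n]] mult_left_mono[OF _ MN(1)] unfolding e_def by fastforce
    qed
    have "e \<longlonglongrightarrow> C1 * (0 + 0)" unfolding e_def by (intro tendsto_intros a b)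
    then have e0: "e \<longlonglongrightarrow> 0" by simp
    let ?r = "\<lambda>x. T f x - h x"
    have r: "?r \<in> cplx_space V" by (intro N.cplx_diff_mem T_mem f h)
    have "cplx_norm M ?r \<le> (cmod z + q) * e n + cmod z * (cplx_norm M (d 0) * p ^ n)" for n
    proof -
      let ?w = "\<lambda>x. u n x - f x"
      \<comment> \<open>The iteration gives \<open>z * d n = h - T (u n)\<close>. The residual thus
        splits into the image of the approximation error and a multiple of the increment, both of
        which tend to 0.\<close>
      have "?r = (\<lambda>x. (-1) * T ?w x + (- z) * d n x)"
        unfolding T_diff[OF u_mem[of n] f] using z0 by (simp add: T_def d_def u_Suc fun_eq_iff field_simps)
      then have "cplx_norm M ?r \<le> cplx_norm M (\<lambda>x. (-1) * T ?w x) + cplx_norm M (\<lambda>x. (- z) * d n x)"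
        using M.cplx_norm_add[OF M.cplx_scale_mem[OF T_mem[OF uf[of n]], of "-1"] M.cplx_scale_mem[OF d_mem[of n], of "- z"]] by simp
      also have "\<dots> = cplx_norm M (T ?w) + cmod z * cplx_norm M (d n)"
        by (simp only: M.cplx_norm_scale[OF T_mem[OF uf[of n]]] M.cplx_norm_scale[OF d_mem]) simp
      also have "\<dots> \<le> (cmod z + q) * e n + cmod z * (cplx_norm M (d 0) * p ^ n)"
        using q by (intro add_mono mult_left_mono d_bound order_trans[OF T_upper[OF uf[of n]]] e) auto
      finally show ?thesis .
    qed
    moreover have "(\<lambda>n. (cmod z + q) * e n + cmod z * (cplx_norm M (d 0) * p ^ n))
        \<longlonglongrightarrow> (cmod z + q) * 0 + cmod z * (cplx_norm M (d 0) * 0)"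
      using p by (intro tendsto_intros e0 LIMSEQ_realpow_zero) auto
    ultimately have "cplx_norm M ?r \<le> 0"
      by (intro LIMSEQ_le_const[of "\<lambda>n. (cmod z + q) * e n + cmod z * (cplx_norm M (d 0) * p ^ n)"]) auto
    then have "?r = (\<lambda>x. 0)" by (rule null[OF r])
    then have "h = T f" by (simp add: fun_eq_iff)
    then show ?thesis using f by blast
  qed
  ultimately have bij: "bij_betw T (cplx_space V) (cplx_space V)"
    using T_mem unfolding bij_betw_def by blast
  have "cplx_norm N f \<le> C2 * (C1 / (cmod z - q)) * cplx_norm N (T f)" if f: "f \<in> cplx_space V" for f
  proof -
    have "(cmod z - q) * cplx_norm M f \<le> C1 * cplx_norm N (T f)"
      using T_lower[OF f] cplx_norm_mono[OF M N MN T_mem[OF f]] by simp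
    then have "cplx_norm M f \<le> C1 / (cmod z - q) * cplx_norm N (T f)"
      using q by (simp add: field_simps)
    then show ?thesis
      using cplx_norm_mono[OF N M NM f] mult_left_mono[OF _ NM(1)] by (fastforce simp: mult.assoc)
  qed
  then show ?thesis using bij unfolding resolvent_set_def T_def K_def by blast
qed

section \<open>The Banach space \<open>C\<^sup>m\<close>\<close>

text \<open>The error bound depends on the sequence only through \<open>A\<close> and
  \<open>q\<close>. Applied at every point of \<open>H\<close>, it makes pointwise limits
  uniform.\<close>

lemma geometric_Cauchy_limit:
  fixes a :: "nat \<Rightarrow> real"
  assumes "0 \<le> q" "q < 1" "\<And>n. \<bar>a (Suc n) - a n\<bar> \<le> A * q ^ n"
  obtains l where "a \<longlonglongrightarrow> l" "\<And>n. \<bar>a n - l\<bar> \<le> A / (1 - q) * q ^ n"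
proof -
  have A: "0 \<le> A" using assms(3)[of 0] by simp
  \<comment> \<open>With \<open>q ^ (n + j)\<close> subtracted the bound is the exact finite
    geometric sum, and the induction closes.\<close>
  have "\<bar>a (n + j) - a n\<bar> \<le> A / (1 - q) * (q ^ n - q ^ (n + j))" for n j
  proof (induction j)
    case (Suc j)
    have "\<bar>a (n + Suc j) - a n\<bar> \<le> A * q ^ (n + j) + A / (1 - q) * (q ^ n - q ^ (n + j))"
      using Suc assms(3)[of "n + j"] by simp
    also have "\<dots> = A / (1 - q) * (q ^ n - q ^ (n + Suc j))"
      using assms(2) by (simp add: field_simps)
    finally show ?case .
  qed simp
  moreover have "A / (1 - q) * (q ^ n - q ^ (n + j)) \<le> A / (1 - q) * q ^ n" for n j
    using A assms(1,2) by (intro mult_left_mono) auto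
  ultimately have bnd: "\<bar>a (n + j) - a n\<bar> \<le> A / (1 - q) * q ^ n" for n j
    by (meson order_trans)
  have lim0: "(\<lambda>n. A / (1 - q) * q ^ n) \<longlonglongrightarrow> 0"
    by (rule tendsto_mult_right_zero[OF LIMSEQ_realpow_zero[OF assms(1,2)]])
  have "Cauchy a"
  proof (rule CauchyI')
    fix e :: real assume "e > 0"
    then obtain M where M: "\<bar>A / (1 - q) * q ^ n\<bar> < e" if "n \<ge> M" for n
      using LIMSEQ_D[OF lim0, of e] by auto
    have "dist (a m) (a n) < e" if "m \<ge> M" "n > m" for m n
    proof -
      have "\<bar>a n - a m\<bar> \<le> A / (1 - q) * q ^ m" using bnd[of m "n - m"] that by simp
      then show ?thesis using M[OF that(1)] unfolding dist_real_def by linarith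
    qed
    then show "\<exists>M. \<forall>m\<ge>M. \<forall>n>m. dist (a m) (a n) < e" by blast
  qed
  then obtain l where l: "a \<longlonglongrightarrow> l" using Cauchy_convergent_iff convergent_def by blast
  have "\<bar>a n - l\<bar> \<le> A / (1 - q) * q ^ n" for n
  proof (rule LIMSEQ_le_const2)
    show "(\<lambda>j. \<bar>a n - a (j + n)\<bar>) \<longlonglongrightarrow> \<bar>a n - l\<bar>"
      by (intro tendsto_intros LIMSEQ_ignore_initial_segment l)
    show "\<exists>N. \<forall>j\<ge>N. \<bar>a n - a (j + n)\<bar> \<le> A / (1 - q) * q ^ n"
      using bnd[of n] by (simp add: abs_minus_commute add.commute)
  qed
  with l show thesis by (rule that)
qed

text \<open>For bounded \<open>H\<close>, extending continuously to the compact closure amounts to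
  uniform continuity on \<open>H\<close>, a property that survives uniform limits.\<close>

lemma ext_continuous_uniform_limit:
  assumes "bounded H" "\<And>n. ext_continuous H (f n)"
    and close: "\<And>n x. x \<in> H \<Longrightarrow> \<bar>f n x - v x\<bar> \<le> E n" and E: "E \<longlonglongrightarrow> (0::real)"
  shows "ext_continuous H v"
proof -
  have uc: "uniformly_continuous_on H (f n)" for n
  proof -
    obtain w where w: "continuous_on (closure H) w" "\<forall>x\<in>H. w x = f n x"
      using assms(2) unfolding ext_continuous_def by blast
    then have "uniformly_continuous_on (closure H) w"
      using assms(1) by (intro compact_uniformly_continuous) auto
    then have "uniformly_continuous_on H w"
      unfolding uniformly_continuous_on_def using closure_subset[of H] by (meson subset_iff)
    then show ?thesis using w(2) unfolding uniformly_continuous_on_def by simp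
  qed
  have "uniformly_continuous_on H v"
    unfolding uniformly_continuous_on_def
  proof (intro allI impI)
    fix e :: real assume e: "e > 0"
    then obtain n where n: "\<bar>E n\<bar> < e / 3"
      using LIMSEQ_D[OF E, of "e / 3"] by auto
    obtain d where d: "d > 0" "\<And>x y. x \<in> H \<Longrightarrow> y \<in> H \<Longrightarrow> dist y x < d \<Longrightarrow> dist (f n y) (f n x) < e / 3"
      using uniformly_continuous_onE[OF uc[of n], of "e / 3"] e by auto
    have "dist (v y) (v x) < e" if "x \<in> H" "y \<in> H" "dist y x < d" for x y
      using d(2)[OF that] close[OF that(1), of n] close[OF that(2), of n] n unfolding dist_real_def by arith
    then show "\<exists>d>0. \<forall>x\<in>H. \<forall>x'\<in>H. dist x' x < d \<longrightarrow> dist (v x') (v x) < e"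
      using d(1) by blast
  qed
  then obtain g where "uniformly_continuous_on (closure H) g" "\<And>x. x \<in> H \<Longrightarrow> v x = g x"
    by (rule uniformly_continuous_on_extension_on_closure) blast
  then show ?thesis
    unfolding ext_continuous_def
    by (intro exI[of _ g] conjI ballI) (simp_all add: uniformly_continuous_imp_continuous)
qed

lemma has_field_derivative_uniform_limit:
  fixes f f' :: "nat \<Rightarrow> real \<Rightarrow> real"
  assumes "open H" "x \<in> H"
    and der: "\<And>n y. y \<in> H \<Longrightarrow> (f n has_field_derivative f' n y) (at y)"
    and lim: "\<And>y. y \<in> H \<Longrightarrow> (\<lambda>n. f n y) \<longlonglongrightarrow> v y"
    and close: "\<And>n y. y \<in> H \<Longrightarrow> \<bar>f' n y - v' y\<bar> \<le> E n" and E: "E \<longlonglongrightarrow> 0"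
  shows "(v has_field_derivative v' x) (at x)"
proof -
  \<comment> \<open>\<open>has_derivative_sequence\<close> wants a convex domain, hence the ball. It
    returns some limit \<open>g\<close>, which agrees with \<open>v\<close> on the ball by
    uniqueness of limits.\<close>
  obtain r where r: "r > 0" "ball x r \<subseteq> H" using assms(1,2) open_contains_ball by blast
  then have x: "x \<in> ball x r" by simp
  have "\<exists>g. \<forall>y\<in>ball x r. (\<lambda>n. f n y) \<longlonglongrightarrow> g y \<and> (g has_derivative (*) (v' y)) (at y within ball x r)"
  proof (rule has_derivative_sequence[where f = f and f' = "\<lambda>n y. (*) (f' n y)", OF convex_ball _ _ x lim[OF assms(2)]])
    show "(f n has_derivative (*) (f' n y)) (at y within ball x r)" if "y \<in> ball x r" for n y
      using der[of y n] that r(2) has_derivative_at_withinI unfolding has_field_derivative_def by blast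
    fix e :: real assume "e > 0"
    then have "\<forall>\<^sub>F n in sequentially. dist (E n) 0 < e" by (rule tendstoD[OF E])
    then show "\<forall>\<^sub>F n in sequentially. \<forall>y\<in>ball x r. \<forall>h. norm (f' n y * h - v' y * h) \<le> e * norm h"
    proof eventually_elim
      case (elim n)
      have "norm (f' n y * h - v' y * h) \<le> e * norm h" if "y \<in> ball x r" for y h
      proof -
        have "\<bar>f' n y - v' y\<bar> \<le> e" using close[of y n] that r(2) elim by auto
        then show ?thesis
          by (simp add: left_diff_distrib[symmetric] abs_mult mult_right_mono)
      qed
      then show ?case by blast
    qed
  qed
  then obtain g where g: "\<And>y. y \<in> ball x r \<Longrightarrow> (\<lambda>n. f n y) \<longlonglongrightarrow> g y"
    "(g has_derivative (*) (v' x)) (at x within ball x r)" using x by blast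
  have "(g has_derivative (*) (v' x)) (at x)" using g(2) at_within_open[OF x open_ball] by simp
  moreover have "g y = v y" if "y \<in> ball x r" for y
    using g(1)[OF that] lim[of y] that r(2) LIMSEQ_unique by blast
  ultimately have "(v has_derivative (*) (v' x)) (at x)"
    by (rule has_derivative_transform_within_open[OF _ open_ball x])
  then show ?thesis by (simp add: has_field_derivative_def)
qed

section \<open>Linear structure, norm and completeness of \<open>Cm_space\<close>\<close>

lemma Cm_space_iff:
  "w \<in> Cm_space m H \<longleftrightarrow> continuous_on (closure H) w \<and> Cm_ext m H w \<and> (\<forall>x. x \<notin> closure H \<longrightarrow> w x = 0)"
  unfolding Cm_space_def Cm_closure_iff by blast

lemma Cm_space_lincomb:
  assumes "open H" "u \<in> Cm_space m H" "v \<in> Cm_space m H"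
  shows "(\<lambda>x. a * u x + b * v x) \<in> Cm_space m H"
  using assms(2,3) unfolding Cm_space_iff
  by (simp add: continuous_intros Cm_ext_add Cm_ext_mult Cm_ext_const assms(1))

lemma Cm_space_deriv_bounded:
  assumes "bounded H" "w \<in> Cm_space m H"
  obtains C where "C > 0" "\<And>k x. k \<le> m \<Longrightarrow> x \<in> H \<Longrightarrow> \<bar>(deriv ^^ k) w x\<bar> \<le> C"
proof -
  have "\<exists>C. \<forall>x\<in>H. \<bar>(deriv ^^ k) w x\<bar> \<le> C" if "k \<le> m" for k
  proof -
    have "ext_continuous H ((deriv ^^ k) w)"
      using assms(2) that unfolding Cm_space_iff Cm_ext_iff by blast
    then show ?thesis using assms(1) by (rule ext_continuous_bounded) blast
  qed
  then obtain C where C: "\<And>k x. k \<le> m \<Longrightarrow> x \<in> H \<Longrightarrow> \<bar>(deriv ^^ k) w x\<bar> \<le> C k" by metis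
  have "\<bar>(deriv ^^ k) w x\<bar> \<le> 1 + (\<Sum>j\<le>m. \<bar>C j\<bar>)" if "k \<le> m" "x \<in> H" for k x
    using C[OF that] member_le_sum[of k "{..m}" "\<lambda>j. \<bar>C j\<bar>"] that by simp
  moreover have "1 + (\<Sum>j\<le>m. \<bar>C j\<bar>) > 0" by (simp add: add_pos_nonneg sum_nonneg)
  ultimately show thesis using that by blast
qed

lemma Cm_norm_upper:
  assumes "bounded H" "w \<in> Cm_space m H" "k \<le> m" "x \<in> H"
  shows "\<bar>(deriv ^^ k) w x\<bar> \<le> Cm_norm m H w"
proof -
  obtain C where C: "\<And>k x. k \<le> m \<Longrightarrow> x \<in> H \<Longrightarrow> \<bar>(deriv ^^ k) w x\<bar> \<le> C"
    using Cm_space_deriv_bounded[OF assms(1,2)] by metis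
  have "(\<lambda>(k, x). \<bar>(deriv ^^ k) w x\<bar>) (k, x) \<le> Cm_norm m H w"
    unfolding Cm_norm_def using assms(3,4) C
    by (intro cSUP_upper bdd_aboveI2[where M = C]) auto
  then show ?thesis by simp
qed

lemma Cm_norm_least:
  assumes "H \<noteq> {}" "\<And>k x. k \<le> m \<Longrightarrow> x \<in> H \<Longrightarrow> \<bar>(deriv ^^ k) w x\<bar> \<le> c"
  shows "Cm_norm m H w \<le> c"
  unfolding Cm_norm_def by (rule cSUP_least) (use assms in auto)

lemma funpow_deriv_scale:
  assumes "open H" "w \<in> Cm_space m H" "k \<le> m" "x \<in> H"
  shows "(deriv ^^ k) (\<lambda>x. a * w x) x = a * (deriv ^^ k) w x"
  using funpow_deriv_linear[of H m w w k x a 0] assms unfolding Cm_space_iff by simp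

lemma funpow_deriv_add:
  assumes "open H" "u \<in> Cm_space m H" "v \<in> Cm_space m H" "k \<le> m" "x \<in> H"
  shows "(deriv ^^ k) (\<lambda>x. u x + v x) x = (deriv ^^ k) u x + (deriv ^^ k) v x"
  using funpow_deriv_linear[of H m u v k x 1 1] assms unfolding Cm_space_iff by simp

lemma funpow_deriv_diff:
  assumes "open H" "u \<in> Cm_space m H" "v \<in> Cm_space m H" "k \<le> m" "x \<in> H"
  shows "(deriv ^^ k) (\<lambda>x. u x - v x) x = (deriv ^^ k) u x - (deriv ^^ k) v x"
  using funpow_deriv_linear[of H m u v k x 1 "-1"] assms unfolding Cm_space_iff by simp

lemma zero_mem_Cm_space: "(\<lambda>x. 0) \<in> Cm_space m H"
  unfolding Cm_space_iff by (simp add: Cm_ext_const)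

lemma seminormed_functions_Cm:
  assumes "open H" "bounded H" "H \<noteq> {}"
  shows "seminormed_functions (Cm_space m H) (Cm_norm m H)"
proof (rule seminormed_functionsI)
  show "(\<lambda>x. 0) \<in> Cm_space m H" by (rule zero_mem_Cm_space)
  show "(\<lambda>x. a * u x + b * v x) \<in> Cm_space m H" if "u \<in> Cm_space m H" "v \<in> Cm_space m H" for u v a b
    by (rule Cm_space_lincomb[OF assms(1) that])
  fix u assume u: "u \<in> Cm_space m H"
  show "Cm_norm m H (\<lambda>x. u x + v x) \<le> Cm_norm m H u + Cm_norm m H v" if v: "v \<in> Cm_space m H" for v
    using Cm_norm_upper[OF assms(2) u] Cm_norm_upper[OF assms(2) v]
    by (intro Cm_norm_least[OF assms(3)]) (auto simp: funpow_deriv_add[OF assms(1) u v]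
      intro!: order_trans[OF abs_triangle_ineq] add_mono)
  show "Cm_norm m H (\<lambda>x. a * u x) \<le> \<bar>a\<bar> * Cm_norm m H u" for a
    using Cm_norm_upper[OF assms(2) u]
    by (intro Cm_norm_least[OF assms(3)]) (auto simp: funpow_deriv_scale[OF assms(1) u] abs_mult
      intro!: mult_left_mono)
  show "0 \<le> Cm_norm m H u"
    using Cm_norm_upper[OF assms(2) u, of 0] assms(3) by fastforce
qed

text \<open>The norm sees only points of \<open>H\<close>. Continuity carries the value 0 to the
  closure, and beyond it elements of \<open>Cm_space\<close> vanish by convention.\<close>

lemma Cm_norm_definite:
  assumes "bounded H" "w \<in> Cm_space m H" "Cm_norm m H w = 0"
  shows "w = (\<lambda>x. 0)"
proof
  fix x
  have "w y = 0" if "y \<in> H" for y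
    using Cm_norm_upper[OF assms(1,2) _ that, of 0] assms(3) by simp
  moreover have "continuous_on (closure H) w" "\<And>x. x \<notin> closure H \<Longrightarrow> w x = 0"
    using assms(2) by (auto simp: Cm_space_iff)
  ultimately show "w x = 0" using continuous_constant_on_closure[of H w 0 x] by blast
qed

text \<open>The derivatives of each order converge uniformly on \<open>H\<close>, and each limit is
  the derivative of the one before. Geometric convergence is the only case that the Neumann series
  calls for.\<close>

lemma Cm_norm_complete:
  assumes "open H" "bounded H" "H \<noteq> {}" and u: "\<And>n. u n \<in> Cm_space m H"
    and q: "0 \<le> q" "q < 1" and step: "\<And>n. Cm_norm m H (\<lambda>x. u (Suc n) x - u n x) \<le> A * q ^ n"
  shows "\<exists>l\<in>Cm_space m H. (\<lambda>n. Cm_norm m H (\<lambda>x. u n x - l x)) \<longlonglongrightarrow> 0"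
proof -
  interpret seminormed_functions "Cm_space m H" "Cm_norm m H"
    by (rule seminormed_functions_Cm[OF assms(1-3)])
  define E where "E n = A / (1 - q) * q ^ n" for n
  have E: "E \<longlonglongrightarrow> 0"
    unfolding E_def by (rule tendsto_mult_right_zero[OF LIMSEQ_realpow_zero[OF q]])
  have "\<exists>l. (\<lambda>n. (deriv ^^ k) (u n) x) \<longlonglongrightarrow> l \<and> (\<forall>n. \<bar>(deriv ^^ k) (u n) x - l\<bar> \<le> E n)"
    if "k \<le> m" "x \<in> H" for k x
  proof -
    have "\<bar>(deriv ^^ k) (u (Suc n)) x - (deriv ^^ k) (u n) x\<bar> \<le> A * q ^ n" for n
      using Cm_norm_upper[OF assms(2) diff_mem[OF u u] that, of "Suc n" n] step[of n]
        funpow_deriv_diff[OF assms(1) u u that, of "Suc n" n] by simp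
    from geometric_Cauchy_limit[OF q this] show ?thesis unfolding E_def by metis
  qed
  then obtain v where v: "\<And>k x. k \<le> m \<Longrightarrow> x \<in> H \<Longrightarrow> (\<lambda>n. (deriv ^^ k) (u n) x) \<longlonglongrightarrow> v k x"
    "\<And>k x n. k \<le> m \<Longrightarrow> x \<in> H \<Longrightarrow> \<bar>(deriv ^^ k) (u n) x - v k x\<bar> \<le> E n" by metis
  have ext: "ext_continuous H (v k)" if "k \<le> m" for k
  proof (rule ext_continuous_uniform_limit[OF assms(2) _ v(2)[OF that] E])
    show "ext_continuous H ((deriv ^^ k) (u n))" for n
      using u[of n] that unfolding Cm_space_iff Cm_ext_iff by blast
  qed
  have der: "(v k has_field_derivative v (Suc k) x) (at x)" if "k < m" "x \<in> H" for k x
  proof (rule has_field_derivative_uniform_limit[OF assms(1) that(2) _ v(1) _ E])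
    fix n y assume y: "y \<in> H"
    have "(deriv ^^ k) (u n) differentiable at y"
      using u[of n] that y unfolding Cm_space_iff Cm_ext_iff by blast
    then show "((deriv ^^ k) (u n) has_field_derivative (deriv ^^ Suc k) (u n) y) (at y)"
      by (simp add: DERIV_deriv_iff_real_differentiable)
    show "\<bar>(deriv ^^ Suc k) (u n) y - v (Suc k) y\<bar> \<le> E n"
      using that y by (intro v(2)) auto
  qed (use that in auto)
  obtain e where e: "continuous_on (closure H) e" "\<And>x. x \<in> H \<Longrightarrow> e x = v 0 x"
    using ext[of 0] unfolding ext_continuous_def by auto
  \<comment> \<open>The limit has to be the canonical representative: the continuous extension of
    \<open>v 0\<close> on the closure, and 0 elsewhere.\<close>
  define l where "l x = (if x \<in> closure H then e x else 0)" for x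
  have l: "(deriv ^^ k) l x = v k x" if "k \<le> m" "x \<in> H" for k x
    using that
  proof (induction k arbitrary: x)
    case 0
    then show ?case using e(2) closure_subset[of H] by (auto simp: l_def)
  next
    case (Suc k)
    have "deriv ((deriv ^^ k) l) x = deriv (v k) x"
      using Suc by (intro deriv_cong_open[OF assms(1)]) auto
    then show ?case using der[of k x] Suc.prems by (simp add: DERIV_imp_deriv)
  qed
  have "l \<in> Cm_space m H"
    unfolding Cm_space_iff Cm_ext_iff
  proof (intro conjI allI impI ballI)
    show "continuous_on (closure H) l"
      using e(1) by (rule continuous_on_eq) (simp add: l_def)
    show "(deriv ^^ k) l differentiable at x" if "k < m" "x \<in> H" for k x
    proof (rule differentiable_cong_open[OF assms(1) that(2)])
      show "v k y = (deriv ^^ k) l y" if "y \<in> H" for y using l that \<open>k < m\<close> by simp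
      show "v k differentiable at x" using der[OF that] by (auto simp: real_differentiable_def)
    qed
    show "ext_continuous H ((deriv ^^ k) l)" if "k \<le> m" for k
      using ext_continuous_cong[of H "v k" "(deriv ^^ k) l"] ext[OF that] l[OF that] by simp
  qed (simp add: l_def)
  moreover have "(\<lambda>n. Cm_norm m H (\<lambda>x. u n x - l x)) \<longlonglongrightarrow> 0"
  proof (rule tendsto_sandwich[OF _ _ tendsto_const E])
    show "\<forall>\<^sub>F n in sequentially. 0 \<le> Cm_norm m H (\<lambda>x. u n x - l x)"
      using N_nonneg[OF diff_mem[OF u \<open>l \<in> Cm_space m H\<close>]] by simp
    show "\<forall>\<^sub>F n in sequentially. Cm_norm m H (\<lambda>x. u n x - l x) \<le> E n"
      using v(2) l funpow_deriv_diff[OF assms(1) u \<open>l \<in> Cm_space m H\<close>]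
      by (intro always_eventually allI Cm_norm_least[OF assms(3)]) simp
  qed
  ultimately show ?thesis by blast
qed

section \<open>Derivatives of weighted compositions\<close>

text \<open>The coefficient of the \<open>j\<close>-th derivative of \<open>w\<close> at \<open>t x\<close> in the \<open>k\<close>-th derivative of \<open>G \<cdot> (w \<circ> t)\<close>.\<close>

primrec comp_coeff :: "(real \<Rightarrow> real) \<Rightarrow> (real \<Rightarrow> real) \<Rightarrow> nat \<Rightarrow> nat \<Rightarrow> real \<Rightarrow> real" where
  "comp_coeff G t 0 j = (if j = 0 then G else (\<lambda>_. 0))"
| "comp_coeff G t (Suc k) j =
     (\<lambda>x. deriv (comp_coeff G t k j) x + (if j = 0 then 0 else comp_coeff G t k (j - 1) x * deriv t x))"

lemma comp_coeff_above: "k < j \<Longrightarrow> comp_coeff G t k j = (\<lambda>_. 0)"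
proof (induction k arbitrary: j)
  case (Suc k)
  then have "comp_coeff G t k j = (\<lambda>_. 0)" "comp_coeff G t k (j - 1) = (\<lambda>_. 0)" by auto
  then show ?case using Suc.prems by simp
qed simp

text \<open>Only this top coefficient will matter for the spectral bound. Its factor
  \<open>deriv t x ^ k\<close> is what the conformal factor absorbs.\<close>

lemma comp_coeff_diag: "comp_coeff G t k k = (\<lambda>x. G x * deriv t x ^ k)"
  by (induction k) (simp_all add: comp_coeff_above fun_eq_iff)

text \<open>Each step of the recursion differentiates the coefficients once and so costs one order
  of smoothness.\<close>

lemma Cm_ext_comp_coeff:
  assumes "open H" "Cm_ext m H G" "Cm_ext m H t"
  shows "k \<le> m \<Longrightarrow> Cm_ext (m - k) H (comp_coeff G t k j)"
proof (induction k arbitrary: j)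
  case 0
  then show ?case using assms(2) Cm_ext_const by auto
next
  case (Suc k)
  define n where "n = m - Suc k"
  have n: "m - k = Suc n" using Suc.prems by (simp add: n_def)
  have IH: "Cm_ext (Suc n) H (comp_coeff G t k i)" for i using Suc.IH[of i] Suc.prems n by simp
  have "Cm_ext (Suc n) H t" using Cm_ext_mono[OF assms(3), of "Suc n"] n by simp
  then have "Cm_ext n H (\<lambda>x. comp_coeff G t k i x * deriv t x)" for i
    using Cm_ext_mult[OF assms(1) Cm_ext_SucD[OF IH]] by simp
  then have "Cm_ext n H (\<lambda>x. if j = 0 then 0 else comp_coeff G t k (j - 1) x * deriv t x)"
    using Cm_ext_const by (cases "j = 0") simp_all
  moreover have "Cm_ext n H (deriv (comp_coeff G t k j))" using IH[of j] by simp
  ultimately show ?case unfolding n_def[symmetric] comp_coeff.simps by (intro Cm_ext_add[OF assms(1)])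
qed

lemma funpow_deriv_weighted_comp:
  assumes "open H" "Cm_ext m H G" "Cm_ext m H t" "t ` H \<subseteq> H" "Cm_ext m H w"
  shows "k \<le> m \<Longrightarrow> x \<in> H \<Longrightarrow>
    (deriv ^^ k) (\<lambda>x. G x * w (t x)) x = (\<Sum>j\<le>k. comp_coeff G t k j x * (deriv ^^ j) w (t x))"
proof (induction k arbitrary: x)
  case (Suc k)
  let ?c = "comp_coeff G t k" and ?D = "\<lambda>j. (deriv ^^ j) w"
  have c: "(?c j has_field_derivative deriv (?c j) x) (at x)" for j
  proof -
    have "Cm_ext (Suc (m - Suc k)) H (?c j)"
      using Cm_ext_comp_coeff[OF assms(1,2,3), of k j] Suc.prems by (simp add: Suc_diff_Suc del: Cm_ext.simps)
    then show ?thesis using Suc.prems(2) by (rule has_deriv_Cm_ext)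
  qed
  have t: "(t has_field_derivative deriv t x) (at x)"
    using has_deriv_Cm_ext[of 0 H t x] Cm_ext_mono[OF assms(3), of "Suc 0"] Suc.prems by simp
  have w: "(?D j has_field_derivative ?D (Suc j) (t x)) (at (t x))" if "j \<le> k" for j
  proof -
    have "t x \<in> H" using assms(4) Suc.prems by auto
    then have "?D j differentiable at (t x)" using assms(5) that Suc.prems unfolding Cm_ext_iff by auto
    then show ?thesis by (simp add: DERIV_deriv_iff_real_differentiable)
  qed
  have "((\<lambda>y. \<Sum>j\<le>k. ?c j y * ?D j (t y)) has_field_derivative
      (\<Sum>j\<le>k. deriv (?c j) x * ?D j (t x) + ?D (Suc j) (t x) * deriv t x * ?c j x)) (at x)"
    by (intro DERIV_sum DERIV_mult c DERIV_chain2[OF w t]) simp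
  moreover have "deriv ((deriv ^^ k) (\<lambda>x. G x * w (t x))) x = deriv (\<lambda>y. \<Sum>j\<le>k. ?c j y * ?D j (t y)) x"
    using Suc by (intro deriv_cong_open[OF assms(1)]) auto
  ultimately have "(deriv ^^ Suc k) (\<lambda>x. G x * w (t x)) x =
      (\<Sum>j\<le>k. deriv (?c j) x * ?D j (t x)) + (\<Sum>j\<le>k. ?c j x * deriv t x * ?D (Suc j) (t x))"
    by (simp add: DERIV_imp_deriv sum.distrib mult_ac)
  \<comment> \<open>Both sums are brought to the range up to \<open>Suc k\<close>, the first by
    adding a zero term and the second by an index shift, to match the recursion of
    \<open>comp_coeff\<close>.\<close>
  also have "(\<Sum>j\<le>k. deriv (?c j) x * ?D j (t x)) = (\<Sum>j\<le>Suc k. deriv (?c j) x * ?D j (t x))"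
    by (simp add: comp_coeff_above)
  also have "(\<Sum>j\<le>k. ?c j x * deriv t x * ?D (Suc j) (t x)) =
      (\<Sum>j\<le>Suc k. (if j = 0 then 0 else ?c (j - 1) x * deriv t x) * ?D j (t x))"
    by (subst sum.atMost_Suc_shift) simp
  finally show ?case by (simp add: sum.distrib[symmetric] distrib_right)
qed simp

lemma Cm_ext_ident: "Cm_ext m H (\<lambda>x. x)"
proof (cases m)
  case 0
  then show ?thesis by (auto intro!: ext_continuous_I)
next
  case (Suc n)
  then show ?thesis using Cm_ext_const[of n H 1] by (auto intro!: ext_continuous_I)
qed

lemma deriv_le_of_Lipschitz:
  fixes f :: "real \<Rightarrow> real"
  assumes "open H" "x \<in> H" "\<And>y. y \<in> H \<Longrightarrow> \<bar>f y - f x\<bar> \<le> c * \<bar>y - x\<bar>"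
    and "(f has_field_derivative D) (at x)"
  shows "\<bar>D\<bar> \<le> c"
proof (rule tendsto_upperbound)
  show "((\<lambda>y. \<bar>(f y - f x) / (y - x)\<bar>) \<longlongrightarrow> \<bar>D\<bar>) (at x)"
    using assms(4) unfolding has_field_derivative_iff by (rule tendsto_rabs)
  have "\<forall>\<^sub>F y in at x. y \<in> H" using assms(1,2) by (simp add: eventually_at_in_open')
  moreover have "\<forall>\<^sub>F y in at x. y \<noteq> x" by (simp add: eventually_at_filter)
  ultimately show "\<forall>\<^sub>F y in at x. \<bar>(f y - f x) / (y - x)\<bar> \<le> c"
    by eventually_elim (use assms(3) in \<open>simp add: divide_le_eq\<close>)
qed simp

section \<open>The transfer operators\<close>

text \<open>Nonempty \<open>H\<close> and \<open>B\<close> keep suprema over \<open>H\<close>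
  meaningful and the radius positive; the degenerate cases are split off in the final
  theorem.\<close>

locale transfer_operator =
  fixes H :: "real set" and B :: "'b set" and m :: nat
    and g \<theta> :: "'b \<Rightarrow> real \<Rightarrow> real"
  assumes open_H: "open H" and bounded_H: "bounded H" and H_ne: "H \<noteq> {}"
    and finite_B: "finite B" and B_ne: "B \<noteq> {}" and m_pos: "m \<ge> 1"
    and g_cont: "\<And>b. b \<in> B \<Longrightarrow> continuous_on (closure H) (g b)"
    and g_Cm: "\<And>b. b \<in> B \<Longrightarrow> Cm_ext m H (g b)"
    and g_pos: "\<And>b x. b \<in> B \<Longrightarrow> x \<in> closure H \<Longrightarrow> g b x > 0"
    and \<theta>_cont: "\<And>b. b \<in> B \<Longrightarrow> continuous_on (closure H) (\<theta> b)"
    and \<theta>_Cm: "\<And>b. b \<in> B \<Longrightarrow> Cm_ext m H (\<theta> b)"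
    and \<theta>_maps: "\<And>b. b \<in> B \<Longrightarrow> \<theta> b ` H \<subseteq> H"
begin

abbreviation V where "V \<equiv> Cm_space m H"

abbreviation L where "L s \<equiv> Lam H B g \<theta> s"

lemma H_closure: "x \<in> H \<Longrightarrow> x \<in> closure H"
  using closure_subset by blast

lemma \<theta>_mem: "b \<in> B \<Longrightarrow> x \<in> H \<Longrightarrow> \<theta> b x \<in> H"
  using \<theta>_maps by blast

lemma weight_Cm: "b \<in> B \<Longrightarrow> Cm_ext m H (\<lambda>x. g b x powr s)"
  using Cm_ext_powr[OF open_H g_cont g_pos g_Cm] by blast

lemma Lam_mem:
  assumes "w \<in> V"
  shows "L s w \<in> V"
  unfolding Cm_space_iff
proof (intro conjI allI impI)
  have w: "continuous_on (closure H) w" "Cm_ext m H w" using assms by (auto simp: Cm_space_iff)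
  have "continuous_on (closure H) (\<lambda>x. g b x powr s * w (\<theta> b x))" if b: "b \<in> B" for b
  proof (intro continuous_on_mult continuous_on_powr continuous_on_const g_cont b ballI)
    show "g b x \<noteq> 0" if "x \<in> closure H" for x using g_pos[OF b that] by simp
    show "continuous_on (closure H) (\<lambda>x. w (\<theta> b x))"
      using continuous_maps_closure[OF \<theta>_cont \<theta>_maps] b
      by (intro continuous_on_compose2[OF w(1) \<theta>_cont[OF b]]) auto
  qed
  then have "continuous_on (closure H) (\<lambda>x. \<Sum>b\<in>B. g b x powr s * w (\<theta> b x))"
    by (intro continuous_on_sum)
  then show "continuous_on (closure H) (L s w)"
    by (rule continuous_on_eq) (simp add: Lam_def)
  have "Cm_ext m H (\<lambda>x. \<Sum>b\<in>B. g b x powr s * w (\<theta> b x))"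
    by (rule Cm_ext_sum[OF open_H finite_B])
      (rule Cm_ext_mult[OF open_H weight_Cm Cm_ext_compose[OF open_H \<theta>_maps w(2) \<theta>_Cm]])
  then show "Cm_ext m H (L s w)"
    by (rule Cm_ext_cong[OF open_H, rotated]) (simp add: Lam_def H_closure)
qed (simp add: Lam_def)

lemma Lam_linear: "L s (\<lambda>x. a * u x + b * v x) x = a * L s u x + b * L s v x"
  by (simp add: Lam_def sum_distrib_left sum.distrib[symmetric] algebra_simps)

lemma funpow_deriv_Lam:
  assumes "w \<in> V" "k \<le> m" "x \<in> H"
  shows "(deriv ^^ k) (L s w) x =
    (\<Sum>b\<in>B. \<Sum>j\<le>k. comp_coeff (\<lambda>x. g b x powr s) (\<theta> b) k j x * (deriv ^^ j) w (\<theta> b x))"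
proof -
  have w: "Cm_ext m H w" using assms(1) by (simp add: Cm_space_iff)
  have "(deriv ^^ k) (L s w) x = (deriv ^^ k) (\<lambda>x. \<Sum>b\<in>B. g b x powr s * w (\<theta> b x)) x"
    by (rule funpow_deriv_cong_open[OF open_H assms(3)]) (simp add: Lam_def H_closure)
  also have "\<dots> = (\<Sum>b\<in>B. (deriv ^^ k) (\<lambda>x. g b x powr s * w (\<theta> b x)) x)"
    by (rule funpow_deriv_sum[OF open_H finite_B _ assms(2,3)])
      (rule Cm_ext_mult[OF open_H weight_Cm Cm_ext_compose[OF open_H \<theta>_maps w \<theta>_Cm]])
  also have "\<dots> = (\<Sum>b\<in>B. \<Sum>j\<le>k. comp_coeff (\<lambda>x. g b x powr s) (\<theta> b) k j x * (deriv ^^ j) w (\<theta> b x))"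
    by (rule sum.cong[OF refl], rule funpow_deriv_weighted_comp[OF open_H weight_Cm \<theta>_Cm \<theta>_maps w assms(2,3)])
  finally show ?thesis .
qed

lemma comp_coeff_bounded:
  obtains C where "C > 0" "\<And>b k j x. b \<in> B \<Longrightarrow> k \<le> m \<Longrightarrow> j \<le> m \<Longrightarrow> x \<in> H \<Longrightarrow>
    \<bar>comp_coeff (\<lambda>x. g b x powr s) (\<theta> b) k j x\<bar> \<le> C"
proof -
  let ?c = "\<lambda>(b, k, j). comp_coeff (\<lambda>x. g b x powr s) (\<theta> b) k j"
  let ?I = "B \<times> {..m} \<times> {..m}"
  have "\<exists>C>0. \<forall>x\<in>H. \<bar>?c i x\<bar> \<le> C" if "i \<in> ?I" for i
  proof -
    obtain b k j where i: "i = (b, k, j)" "b \<in> B" "k \<le> m" using \<open>i \<in> ?I\<close> by auto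
    have "ext_continuous H (?c i)"
      using Cm_ext_imp_ext_continuous[OF Cm_ext_comp_coeff[OF open_H weight_Cm \<theta>_Cm]] i by simp
    then show ?thesis using bounded_H by (rule ext_continuous_bounded) blast
  qed
  then have "\<forall>i\<in>?I. \<exists>C. C > 0 \<and> (\<forall>x\<in>H. \<bar>?c i x\<bar> \<le> C)" by (intro ballI)
  from bchoice[OF this] obtain C where C': "\<forall>i\<in>?I. C i > 0 \<and> (\<forall>x\<in>H. \<bar>?c i x\<bar> \<le> C i)" ..
  have C: "C i > 0" "x \<in> H \<Longrightarrow> \<bar>?c i x\<bar> \<le> C i" if "i \<in> ?I" for i x
    using bspec[OF C' that] by simp_all
  have fin: "finite ?I" using finite_B by auto
  have "\<bar>?c i x\<bar> \<le> sum C ?I + 1" if "i \<in> ?I" "x \<in> H" for i x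
  proof -
    have "C i \<le> sum C ?I" by (rule member_le_sum) (use that(1) fin C(1) in \<open>auto simp: less_imp_le\<close>)
    then show ?thesis using C(2)[OF that] by linarith
  qed
  have "\<bar>comp_coeff (\<lambda>x. g b x powr s) (\<theta> b) k j x\<bar> \<le> sum C ?I + 1"
    if "b \<in> B" "k \<le> m" "j \<le> m" "x \<in> H" for b k j x
    using that \<open>\<And>i x. i \<in> ?I \<Longrightarrow> x \<in> H \<Longrightarrow> \<bar>?c i x\<bar> \<le> sum C ?I + 1\<close>[of "(b, k, j)" x] by simp
  moreover have "sum C ?I + 1 > 0" using sum_nonneg[of ?I C] C(1) by (simp add: less_imp_le add_nonneg_pos)
  ultimately show thesis using that by blast
qed

text \<open>Collatz-Wielandt numbers, with test functions \<open>\<eta>\<close> that need not be continuous.\<close>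

definition admissible :: "real \<Rightarrow> real \<Rightarrow> bool" where
  "admissible s c \<longleftrightarrow> (\<exists>\<eta> a b. 0 < a \<and> (\<forall>x\<in>H. a \<le> \<eta> x \<and> \<eta> x \<le> b) \<and>
     (\<forall>x\<in>H. (\<Sum>i\<in>B. g i x powr s * \<eta> (\<theta> i x)) \<le> c * \<eta> x))"


end

section \<open>Admissible numbers bound the spectrum\<close>

definition weighted_sup :: "'a set \<Rightarrow> ('a \<Rightarrow> real) \<Rightarrow> ('a \<Rightarrow> real) \<Rightarrow> real" where
  "weighted_sup H r w = (SUP x\<in>H. \<bar>w x\<bar> / r x)"

lemma weighted_sup_upper:
  assumes "0 < a" "\<And>x. x \<in> H \<Longrightarrow> a \<le> r x" "\<And>x. x \<in> H \<Longrightarrow> \<bar>w x\<bar> \<le> C" "x \<in> H"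
  shows "\<bar>w x\<bar> \<le> weighted_sup H r w * r x"
proof -
  have "\<bar>w y\<bar> / r y \<le> C / a" if "y \<in> H" for y
    using assms(1) assms(2,3)[OF that] by (intro frac_le) auto
  then have "\<bar>w x\<bar> / r x \<le> weighted_sup H r w"
    unfolding weighted_sup_def by (intro cSUP_upper bdd_aboveI2[where M = "C / a"] assms(4))
  then show ?thesis using assms(1) assms(2)[OF assms(4)] by (simp add: field_simps)
qed

lemma weighted_sup_least:
  assumes "H \<noteq> {}" "\<And>x. x \<in> H \<Longrightarrow> r x > 0" "\<And>x. x \<in> H \<Longrightarrow> \<bar>w x\<bar> \<le> c * r x"
  shows "weighted_sup H r w \<le> c"
  unfolding weighted_sup_def by (rule cSUP_least) (use assms in \<open>auto simp: divide_le_eq\<close>)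

text \<open>The vector \<open>P\<close> is dominated by a lower triangular matrix with diagonal
  \<open>c\<close> applied to \<open>p\<close>. Scaling by powers of \<open>\<epsilon>\<close>
  multiplies the entry at \<open>k\<close>, \<open>j\<close> by \<open>\<epsilon> ^ (k - j)\<close>,
  which is at most \<open>\<epsilon>\<close> below the diagonal.\<close>

lemma triangular_sum_bound:
  fixes p P :: "nat \<Rightarrow> real"
  assumes P: "\<And>k. k \<le> m \<Longrightarrow> P k \<le> c * p k + D * (\<Sum>j<k. p j)" and p: "\<And>k. k \<le> m \<Longrightarrow> 0 \<le> p k"
    and \<epsilon>: "0 < \<epsilon>" "\<epsilon> \<le> 1" and D: "0 \<le> D"
  shows "(\<Sum>k\<le>m. \<epsilon> ^ k * P k) \<le> (c + D * real (Suc m) * \<epsilon>) * (\<Sum>k\<le>m. \<epsilon> ^ k * p k)"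
proof -
  define S where "S = (\<Sum>k\<le>m. \<epsilon> ^ k * p k)"
  have "\<epsilon> ^ k * P k \<le> c * (\<epsilon> ^ k * p k) + D * \<epsilon> * S" if k: "k \<le> m" for k
  proof -
    have "\<epsilon> ^ k * (\<Sum>j<k. p j) = (\<Sum>j<k. \<epsilon> ^ k * p j)" by (simp add: sum_distrib_left)
    also have "\<dots> \<le> (\<Sum>j<k. \<epsilon> * (\<epsilon> ^ j * p j))"
    proof (rule sum_mono)
      fix j assume "j \<in> {..<k}"
      then have "\<epsilon> ^ k \<le> \<epsilon> ^ Suc j" "0 \<le> p j" using \<epsilon> p k power_decreasing[of "Suc j" k \<epsilon>] by simp_all
      then show "\<epsilon> ^ k * p j \<le> \<epsilon> * (\<epsilon> ^ j * p j)"
        using mult_right_mono[of "\<epsilon> ^ k" "\<epsilon> ^ Suc j" "p j"] by (simp add: mult.assoc)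
    qed
    also have "\<dots> \<le> (\<Sum>j\<le>m. \<epsilon> * (\<epsilon> ^ j * p j))"
      using k \<epsilon> p by (intro sum_mono2) auto
    also have "\<dots> = \<epsilon> * S" by (simp add: S_def sum_distrib_left)
    finally have "D * (\<epsilon> ^ k * (\<Sum>j<k. p j)) \<le> D * (\<epsilon> * S)" using D by (rule mult_left_mono)
    moreover have "\<epsilon> ^ k * P k \<le> \<epsilon> ^ k * (c * p k + D * (\<Sum>j<k. p j))"
      using P[OF k] \<epsilon> by (intro mult_left_mono) auto
    ultimately show ?thesis by (simp add: algebra_simps)
  qed
  then have "(\<Sum>k\<le>m. \<epsilon> ^ k * P k) \<le> (\<Sum>k\<le>m. c * (\<epsilon> ^ k * p k) + D * \<epsilon> * S)"
    by (intro sum_mono) simp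
  also have "\<dots> = c * S + real (Suc m) * (D * \<epsilon> * S)"
    by (simp add: sum.distrib sum_distrib_left S_def)
  finally show ?thesis by (simp add: S_def algebra_simps)
qed

locale contracting_transfer_operator = transfer_operator +
  fixes \<mu> :: nat and \<kappa> :: real
  assumes \<mu>_pos: "\<mu> > 0" and \<kappa>_less: "\<kappa> < 1"
    and contraction: "\<And>\<omega> x y. set \<omega> \<subseteq> B \<Longrightarrow> length \<omega> = \<mu> \<Longrightarrow> x \<in> H \<Longrightarrow> y \<in> H \<Longrightarrow>
      \<bar>theta_word \<theta> \<omega> x - theta_word \<theta> \<omega> y\<bar> \<le> \<kappa> * \<bar>x - y\<bar>"
begin

section \<open>Smoothness and derivatives of compositions along words\<close>

lemma theta_word_Cm: "set \<omega> \<subseteq> B \<Longrightarrow> Cm_ext m H (theta_word \<theta> \<omega>)"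
proof (induction \<omega>)
  case Nil
  have "theta_word \<theta> [] = (\<lambda>x. x)" by (simp add: theta_word_def fun_eq_iff)
  then show ?case using Cm_ext_ident by simp
next
  case (Cons b \<omega>)
  have "theta_word \<theta> (b # \<omega>) = (\<lambda>x. theta_word \<theta> \<omega> (\<theta> b x))" by (simp add: theta_word_def fun_eq_iff)
  then show ?case using Cons Cm_ext_compose[OF open_H \<theta>_maps _ \<theta>_Cm] by simp
qed

lemma has_deriv_Cm: "Cm_ext m H f \<Longrightarrow> x \<in> H \<Longrightarrow> (f has_field_derivative deriv f x) (at x)"
  using has_deriv_Cm_ext[of 0 H f x] Cm_ext_mono[of m H f "Suc 0"] m_pos by simp

text \<open>
  An adapted conformal factor: no \<open>\<theta> b\<close> expands lengths measured with \<open>\<sigma> \<bar>dx\<bar>\<close>. Words of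
  length \<open>\<mu>\<close> need not be included in the maximum because their derivatives are at most \<open>\<kappa> < 1\<close>,
  whereas the empty word contributes \<open>1\<close>.
\<close>

lemma conformal_factor:
  obtains \<sigma> S where "\<And>x. x \<in> H \<Longrightarrow> 1 \<le> \<sigma> x" "\<And>x. x \<in> H \<Longrightarrow> \<sigma> x \<le> S"
    "\<And>b x. b \<in> B \<Longrightarrow> x \<in> H \<Longrightarrow> \<bar>deriv (\<theta> b) x\<bar> * \<sigma> (\<theta> b x) \<le> \<sigma> x"
proof -
  define W where "W = {\<omega>. set \<omega> \<subseteq> B \<and> length \<omega> \<le> \<mu> - 1}"
  define d where "d \<omega> x = \<bar>deriv (theta_word \<theta> \<omega>) x\<bar>" for \<omega> x
  define \<sigma> where "\<sigma> x = Max ((\<lambda>\<omega>. d \<omega> x) ` W)" for x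
  have W: "finite W" "[] \<in> W"
    unfolding W_def using finite_lists_length_le[OF finite_B] by simp_all
  have d_le: "d \<omega> x \<le> \<sigma> x" if "\<omega> \<in> W" for \<omega> x
    unfolding \<sigma>_def using that W by (intro Max_ge) auto
  have "theta_word \<theta> [] = (\<lambda>x. x)" by (simp add: theta_word_def fun_eq_iff)
  then have "d [] x = 1" for x by (simp add: d_def)
  then have ge: "1 \<le> \<sigma> x" for x using d_le[OF W(2), of x] by simp
  have "\<exists>C. \<forall>x\<in>H. d \<omega> x \<le> C" if "\<omega> \<in> W" for \<omega>
  proof -
    have "Cm_ext m H (theta_word \<theta> \<omega>)" using that by (intro theta_word_Cm) (simp add: W_def)
    then have "ext_continuous H (deriv (theta_word \<theta> \<omega>))"
      using Cm_ext_mono[of m H "theta_word \<theta> \<omega>" "Suc 0"] m_pos by simp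
    then show ?thesis using bounded_H unfolding d_def by (rule ext_continuous_bounded) blast
  qed
  then have "\<forall>\<omega>\<in>W. \<exists>C. \<forall>x\<in>H. d \<omega> x \<le> C" by (intro ballI)
  from bchoice[OF this] obtain C where C: "\<forall>\<omega>\<in>W. \<forall>x\<in>H. d \<omega> x \<le> C \<omega>" ..
  have le: "\<sigma> x \<le> Max (C ` W)" if "x \<in> H" for x
    unfolding \<sigma>_def
  proof (rule Max.boundedI)
    fix y assume "y \<in> (\<lambda>\<omega>. d \<omega> x) ` W"
    then obtain \<omega> where \<omega>: "\<omega> \<in> W" "y = d \<omega> x" by blast
    have "C \<omega> \<le> Max (C ` W)" using W(1) \<omega>(1) by (intro Max_ge) auto
    then show "y \<le> Max (C ` W)" using C \<omega> that by fastforce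
  qed (use W in auto)
  have step: "\<bar>deriv (\<theta> b) x\<bar> * \<sigma> (\<theta> b x) \<le> \<sigma> x" if b: "b \<in> B" and x: "x \<in> H" for b x
  proof -
    \<comment> \<open>By the chain rule, prefixing \<open>b\<close> to a word that attains the
      maximum at \<open>\<theta> b x\<close> turns the left-hand side into the derivative of the
      longer word at \<open>x\<close>. That word either lies in \<open>W\<close> or has length
      \<open>\<mu>\<close>.\<close>
    have "\<sigma> (\<theta> b x) \<in> (\<lambda>\<omega>. d \<omega> (\<theta> b x)) ` W"
      unfolding \<sigma>_def using W by (intro Max_in) auto
    then obtain \<omega> where \<omega>: "\<omega> \<in> W" "\<sigma> (\<theta> b x) = d \<omega> (\<theta> b x)" by blast
    have set: "set (b # \<omega>) \<subseteq> B" "set \<omega> \<subseteq> B" using \<omega> b by (auto simp: W_def)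
    have "theta_word \<theta> (b # \<omega>) = (\<lambda>x. theta_word \<theta> \<omega> (\<theta> b x))" by (simp add: theta_word_def fun_eq_iff)
    moreover have "((\<lambda>x. theta_word \<theta> \<omega> (\<theta> b x)) has_field_derivative
        deriv (theta_word \<theta> \<omega>) (\<theta> b x) * deriv (\<theta> b) x) (at x)"
      by (rule DERIV_chain2[OF has_deriv_Cm[OF theta_word_Cm[OF set(2)] \<theta>_mem[OF b x]]
            has_deriv_Cm[OF \<theta>_Cm[OF b] x]])
    ultimately have eq: "\<bar>deriv (\<theta> b) x\<bar> * \<sigma> (\<theta> b x) = d (b # \<omega>) x"
      by (simp add: d_def \<omega>(2) DERIV_imp_deriv abs_mult)
    show ?thesis
    proof (cases "length (b # \<omega>) = \<mu>")
      case True
      have "d (b # \<omega>) x \<le> \<kappa>"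
        unfolding d_def
        by (rule deriv_le_of_Lipschitz[OF open_H x contraction[OF set(1) True _ x]
              has_deriv_Cm[OF theta_word_Cm[OF set(1)] x]])
      then show ?thesis using eq ge[of x] \<kappa>_less by simp
    next
      case False
      then have "b # \<omega> \<in> W" using \<omega> set \<mu>_pos by (auto simp: W_def)
      then show ?thesis using eq d_le by simp
    qed
  qed
  show thesis using that[OF ge le step] .
qed

lemma admissible_nonneg: "admissible s c \<Longrightarrow> 0 \<le> c"
proof -
  assume "admissible s c"
  then obtain \<eta> a where \<eta>: "0 < a" "\<And>x. x \<in> H \<Longrightarrow> a \<le> \<eta> x"
    "\<And>x. x \<in> H \<Longrightarrow> (\<Sum>i\<in>B. g i x powr s * \<eta> (\<theta> i x)) \<le> c * \<eta> x"
    unfolding admissible_def by blast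
  obtain x where x: "x \<in> H" using H_ne by blast
  have "0 \<le> (\<Sum>i\<in>B. g i x powr s * \<eta> (\<theta> i x))"
    using \<eta>(1) \<eta>(2)[OF \<theta>_mem[OF _ x]] by (intro sum_nonneg mult_nonneg_nonneg) (auto intro: less_imp_le[OF less_le_trans])
  then have "0 \<le> c * \<eta> x" using \<eta>(3)[OF x] by simp
  then show ?thesis using \<eta>(1) \<eta>(2)[OF x] by (simp add: zero_le_mult_iff)
qed

text \<open>The weights may be discontinuous, but the two-sided bounds on \<open>\<eta>\<close> and
  \<open>\<sigma>\<close> make the weighted norm equivalent to \<open>Cm_norm\<close>, and the
  resolvent set is then found by the Neumann series in the weighted norm.\<close>

theorem resolvent_of_admissible:
  assumes adm: "admissible s c" and z: "c < cmod z"
  shows "z \<in> resolvent_set V (Cm_norm m H) (L s)"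
proof -
  obtain \<eta> a e where a: "0 < a" and \<eta>: "\<And>x. x \<in> H \<Longrightarrow> a \<le> \<eta> x" "\<And>x. x \<in> H \<Longrightarrow> \<eta> x \<le> e"
    and sub: "\<And>x. x \<in> H \<Longrightarrow> (\<Sum>i\<in>B. g i x powr s * \<eta> (\<theta> i x)) \<le> c * \<eta> x"
    using adm unfolding admissible_def by blast
  obtain \<sigma> S where \<sigma>: "\<And>x. x \<in> H \<Longrightarrow> 1 \<le> \<sigma> x" "\<And>x. x \<in> H \<Longrightarrow> \<sigma> x \<le> S"
    and conf: "\<And>b x. b \<in> B \<Longrightarrow> x \<in> H \<Longrightarrow> \<bar>deriv (\<theta> b) x\<bar> * \<sigma> (\<theta> b x) \<le> \<sigma> x"
    by (rule conformal_factor) blast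
  obtain C where C: "C > 0" "\<And>b k j x. b \<in> B \<Longrightarrow> k \<le> m \<Longrightarrow> j \<le> m \<Longrightarrow> x \<in> H \<Longrightarrow>
      \<bar>comp_coeff (\<lambda>x. g b x powr s) (\<theta> b) k j x\<bar> \<le> C"
    by (rule comp_coeff_bounded[of s]) blast
  have c0: "0 \<le> c" by (rule admissible_nonneg[OF adm])
  \<comment> \<open>\<open>r k\<close> divides the \<open>k\<close>-th derivative in the weighted
    norm. Since \<open>S\<close> is at least 1, \<open>R\<close> bounds \<open>r k\<close> for all
    \<open>k\<close> up to \<open>m\<close>.\<close>
  define r where "r k x = \<eta> x * \<sigma> x ^ k" for k x
  define R where "R = e * S ^ m"
  obtain x0 where x0: "x0 \<in> H" using H_ne by blast
  have S1: "1 \<le> S" using \<sigma>[OF x0] by simp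
  have e0: "0 < e" using \<eta>[OF x0] a by simp
  have r_ge: "a \<le> r k x" if "x \<in> H" for k x
  proof -
    have "a * 1 \<le> \<eta> x * \<sigma> x ^ k"
      using a \<eta>(1)[OF that] one_le_power[OF \<sigma>(1)[OF that]] by (intro mult_mono) auto
    then show ?thesis by (simp add: r_def)
  qed
  have r_pos: "0 < r k x" if "x \<in> H" for k x using a r_ge[OF that] by (rule less_le_trans)
  have r_le: "r k x \<le> R" if "x \<in> H" "k \<le> m" for k x
  proof -
    have "\<sigma> x ^ k \<le> S ^ k" using \<sigma>[OF that(1)] by (intro power_mono) auto
    also have "\<dots> \<le> S ^ m" using S1 that(2) by (rule power_increasing[rotated])
    finally show ?thesis
      unfolding r_def R_def using \<eta>(2)[OF that(1)] \<sigma>(1)[OF that(1)] e0 by (intro mult_mono) auto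
  qed
  have R: "0 < R" using S1 e0 by (simp add: R_def)
  define p where "p k w = weighted_sup H (r k) ((deriv ^^ k) w)" for k w
  have p_upper: "\<bar>(deriv ^^ k) w x\<bar> \<le> p k w * r k x" if "w \<in> V" "k \<le> m" "x \<in> H" for k w x
    unfolding p_def using Cm_norm_upper[OF bounded_H that(1,2)] that(3)
    by (intro weighted_sup_upper[OF a r_ge])
  have p_least: "p k w \<le> y" if "\<And>x. x \<in> H \<Longrightarrow> \<bar>(deriv ^^ k) w x\<bar> \<le> y * r k x" for k w y
    unfolding p_def by (rule weighted_sup_least[OF H_ne r_pos that])
  have p_nonneg: "0 \<le> p k w" if "w \<in> V" "k \<le> m" for k w
  proof -
    have "0 \<le> p k w * r k x0" using p_upper[OF that x0] by simp
    then show ?thesis using r_pos[OF x0, of k] by (simp add: zero_le_mult_iff)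
  qed
  \<comment> \<open>The constant for lower-order terms: \<open>card B\<close> branches, coefficients
    at most \<open>C\<close>, \<open>r j\<close> at most \<open>R\<close> at the image point, and
    division by the lower bound \<open>a\<close> of \<open>r k x\<close>.\<close>
  define D where "D = real (card B) * C * R / a"
  have D: "D > 0" using finite_B B_ne C(1) R a by (simp add: D_def card_gt_0_iff)
  have p_Lam: "p k (L s w) \<le> c * p k w + D * (\<Sum>j<k. p j w)" if w: "w \<in> V" and k: "k \<le> m" for k w
  proof (rule p_least)
    fix x assume x: "x \<in> H"
    let ?c = "\<lambda>b. comp_coeff (\<lambda>x. g b x powr s) (\<theta> b) k"
    \<comment> \<open>\<open>?T\<close> collects the diagonal term of each branch, \<open>?Q\<close>
      the terms with derivatives of lower order.\<close>
    let ?T = "\<lambda>b. g b x powr s * \<bar>deriv (\<theta> b) x\<bar> ^ k * \<bar>(deriv ^^ k) w (\<theta> b x)\<bar>"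
    let ?Q = "\<lambda>b. \<Sum>j<k. \<bar>?c b j x * (deriv ^^ j) w (\<theta> b x)\<bar>"
    have "\<bar>(deriv ^^ k) (L s w) x\<bar> \<le> (\<Sum>b\<in>B. \<Sum>j\<le>k. \<bar>?c b j x * (deriv ^^ j) w (\<theta> b x)\<bar>)"
      unfolding funpow_deriv_Lam[OF w k x] by (intro order_trans[OF sum_abs] sum_mono sum_abs)
    also have "\<dots> = (\<Sum>b\<in>B. ?Q b + ?T b)"
      by (intro sum.cong refl)
        (simp add: lessThan_Suc_atMost[symmetric] comp_coeff_diag abs_mult power_abs)
    also have "\<dots> = (\<Sum>b\<in>B. ?T b) + (\<Sum>b\<in>B. ?Q b)" by (simp add: sum.distrib)
    finally have 1: "\<bar>(deriv ^^ k) (L s w) x\<bar> \<le> (\<Sum>b\<in>B. ?T b) + (\<Sum>b\<in>B. ?Q b)" .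
    have "?T b \<le> p k w * \<sigma> x ^ k * (g b x powr s * \<eta> (\<theta> b x))" if b: "b \<in> B" for b
    proof -
      let ?y = "\<theta> b x"
      have y: "?y \<in> H" by (rule \<theta>_mem[OF b x])
      have "?T b \<le> g b x powr s * \<bar>deriv (\<theta> b) x\<bar> ^ k * (p k w * r k ?y)"
        by (intro mult_left_mono p_upper w k y) simp
      \<comment> \<open>Pairing each derivative factor with one factor of \<open>\<sigma>\<close>
        lets the conformal inequality apply. What remains is the sum over branches of the weights
        times \<open>\<eta>\<close>, which admissibility bounds by
        \<open>c * \<eta> x\<close>.\<close>
      also have "\<dots> = p k w * g b x powr s * \<eta> ?y * (\<bar>deriv (\<theta> b) x\<bar> * \<sigma> ?y) ^ k"
        by (simp add: r_def power_mult_distrib)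
      also have "\<dots> \<le> p k w * g b x powr s * \<eta> ?y * \<sigma> x ^ k"
        using p_nonneg[OF w k] \<eta>(1)[OF y] a conf[OF b x] \<sigma>(1)[OF y]
        by (intro mult_left_mono power_mono mult_nonneg_nonneg) auto
      finally show ?thesis by (simp add: mult_ac)
    qed
    then have "(\<Sum>b\<in>B. ?T b) \<le> p k w * \<sigma> x ^ k * (\<Sum>b\<in>B. g b x powr s * \<eta> (\<theta> b x))"
      unfolding sum_distrib_left by (rule sum_mono)
    also have "\<dots> \<le> p k w * \<sigma> x ^ k * (c * \<eta> x)"
      using p_nonneg[OF w k] \<sigma>(1)[OF x] by (intro mult_left_mono sub x mult_nonneg_nonneg) auto
    finally have 2: "(\<Sum>b\<in>B. ?T b) \<le> c * p k w * r k x" by (simp add: r_def mult_ac)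
    have "?Q b \<le> C * R * (\<Sum>j<k. p j w)" if b: "b \<in> B" for b
      unfolding sum_distrib_left
    proof (rule sum_mono)
      fix j assume j: "j \<in> {..<k}"
      have y: "\<theta> b x \<in> H" by (rule \<theta>_mem[OF b x])
      have "\<bar>?c b j x * (deriv ^^ j) w (\<theta> b x)\<bar> \<le> C * (p j w * r j (\<theta> b x))"
        unfolding abs_mult using j k C(1) by (intro mult_mono C(2) b x p_upper w y) auto
      also have "\<dots> \<le> C * (p j w * R)"
        using j k C(1) p_nonneg[OF w, of j] by (intro mult_left_mono r_le y) auto
      finally show "\<bar>?c b j x * (deriv ^^ j) w (\<theta> b x)\<bar> \<le> C * R * p j w" by (simp add: mult_ac)
    qed
    then have "(\<Sum>b\<in>B. ?Q b) \<le> real (card B) * (C * R * (\<Sum>j<k. p j w))"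
      by (rule sum_bounded_above)
    also have "\<dots> = D * (\<Sum>j<k. p j w) * a" using a by (simp add: D_def)
    also have "\<dots> \<le> D * (\<Sum>j<k. p j w) * r k x"
      using D k by (intro mult_left_mono r_ge x mult_nonneg_nonneg sum_nonneg p_nonneg w) auto
    finally show "\<bar>(deriv ^^ k) (L s w) x\<bar> \<le> (c * p k w + D * (\<Sum>j<k. p j w)) * r k x"
      using 1 2 by (simp add: algebra_simps)
  qed
  \<comment> \<open>The quotient keeps the off-diagonal contribution
    \<open>D * real (Suc m) * \<epsilon>\<close> within half the gap between \<open>c\<close> and
    \<open>cmod z\<close>, so that \<open>q\<close> stays below \<open>cmod z\<close>.\<close>
  define \<epsilon> where "\<epsilon> = min 1 ((cmod z - c) / (2 * D * real (Suc m)))"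
  have \<epsilon>: "0 < \<epsilon>" "\<epsilon> \<le> 1" using z D by (auto simp: \<epsilon>_def)
  define q where "q = c + D * real (Suc m) * \<epsilon>"
  have q0: "0 \<le> q" using c0 D \<epsilon> by (simp add: q_def)
  have "D * real (Suc m) * \<epsilon> \<le> D * real (Suc m) * ((cmod z - c) / (2 * D * real (Suc m)))"
    using D by (intro mult_left_mono) (auto simp: \<epsilon>_def)
  also have "\<dots> = (cmod z - c) / 2" using D by (simp add: field_simps del: of_nat_Suc)
  finally have "q \<le> c + (cmod z - c) / 2" unfolding q_def by (rule add_left_mono)
  then have qz: "q < cmod z" using z by (simp add: field_simps)
  define M where "M w = (\<Sum>k\<le>m. \<epsilon> ^ k * p k w)" for w
  interpret N: seminormed_functions V "Cm_norm m H"
    by (rule seminormed_functions_Cm[OF open_H bounded_H H_ne])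
  have M: "seminormed_functions V M"
  proof (rule seminormed_functionsI[OF N.zero_mem N.lincomb_mem])
    fix u assume u: "u \<in> V"
    show "0 \<le> M u"
      unfolding M_def using \<epsilon> by (intro sum_nonneg mult_nonneg_nonneg p_nonneg u) auto
    have "p k (\<lambda>x. t * u x) \<le> \<bar>t\<bar> * p k u" if "k \<le> m" for k t
    proof (rule p_least)
      fix x assume x: "x \<in> H"
      show "\<bar>(deriv ^^ k) (\<lambda>x. t * u x) x\<bar> \<le> \<bar>t\<bar> * p k u * r k x"
        using mult_left_mono[OF p_upper[OF u that x], of "\<bar>t\<bar>"]
        by (simp add: funpow_deriv_scale[OF open_H u that x] abs_mult mult.assoc)
    qed
    then have "\<epsilon> ^ k * p k (\<lambda>x. t * u x) \<le> \<bar>t\<bar> * (\<epsilon> ^ k * p k u)" if "k \<le> m" for k t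
      using mult_left_mono[OF _ zero_le_power[OF less_imp_le[OF \<epsilon>(1)]]] that by (fastforce simp: mult.left_commute)
    then show "M (\<lambda>x. t * u x) \<le> \<bar>t\<bar> * M u" for t
      unfolding M_def sum_distrib_left by (intro sum_mono) simp
    fix v assume v: "v \<in> V"
    have "p k (\<lambda>x. u x + v x) \<le> p k u + p k v" if "k \<le> m" for k
    proof (rule p_least)
      fix x assume x: "x \<in> H"
      show "\<bar>(deriv ^^ k) (\<lambda>x. u x + v x) x\<bar> \<le> (p k u + p k v) * r k x"
        using p_upper[OF u that x] p_upper[OF v that x]
        by (simp add: funpow_deriv_add[OF open_H u v that x] distrib_right)
    qed
    then show "M (\<lambda>x. u x + v x) \<le> M u + M v"
      unfolding M_def sum.distrib[symmetric] distrib_left[symmetric] using \<epsilon>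
      by (intro sum_mono mult_left_mono) auto
  qed
  show ?thesis
  \<comment> \<open>Equivalence of the norms comes from \<open>a \<le> r k x \<le> R\<close> and
    from \<open>\<epsilon> ^ m\<close> being the smallest coefficient in \<open>M\<close>.\<close>
  proof (rule resolvent_set_memI[OF N.seminormed_functions_axioms M, where ?C1.0 = "(\<Sum>k\<le>m. \<epsilon> ^ k) / a"
        and ?C2.0 = "R / \<epsilon> ^ m", OF _ _ _ _ _ _ _ _ _ q0 qz])
    show "0 \<le> (\<Sum>k\<le>m. \<epsilon> ^ k) / a" using \<epsilon> a by (intro divide_nonneg_pos sum_nonneg) auto
    show "0 \<le> R / \<epsilon> ^ m" using \<epsilon> R by simp
    show "M u \<le> (\<Sum>k\<le>m. \<epsilon> ^ k) / a * Cm_norm m H u" if u: "u \<in> V" for u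
    proof -
      have "p k u \<le> Cm_norm m H u / a" if "k \<le> m" for k
      proof (rule p_least)
        fix x assume x: "x \<in> H"
        have "\<bar>(deriv ^^ k) u x\<bar> \<le> Cm_norm m H u / a * a"
          using Cm_norm_upper[OF bounded_H u that x] a by simp
        also have "\<dots> \<le> Cm_norm m H u / a * r k x"
          using N.N_nonneg[OF u] a by (intro mult_left_mono r_ge x) auto
        finally show "\<bar>(deriv ^^ k) u x\<bar> \<le> Cm_norm m H u / a * r k x" .
      qed
      then have "M u \<le> (\<Sum>k\<le>m. \<epsilon> ^ k * (Cm_norm m H u / a))"
        unfolding M_def using \<epsilon> by (intro sum_mono mult_left_mono) auto
      also have "\<dots> = (\<Sum>k\<le>m. \<epsilon> ^ k) * (Cm_norm m H u / a)" by (rule sum_distrib_right[symmetric])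
      finally show ?thesis by simp
    qed
    show "Cm_norm m H u \<le> R / \<epsilon> ^ m * M u" if u: "u \<in> V" for u
    proof (rule Cm_norm_least[OF H_ne])
      fix k x assume k: "k \<le> m" and x: "x \<in> H"
      have "\<epsilon> ^ m * p k u \<le> \<epsilon> ^ k * p k u"
        using \<epsilon> k p_nonneg[OF u k] by (intro mult_right_mono power_decreasing) auto
      also have "\<dots> \<le> M u"
        unfolding M_def using \<epsilon> k u by (intro member_le_sum) (auto intro!: mult_nonneg_nonneg p_nonneg)
      finally have "p k u \<le> M u / \<epsilon> ^ m" using \<epsilon> by (simp add: field_simps)
      then have "p k u * r k x \<le> M u / \<epsilon> ^ m * R"
        using p_nonneg[OF u k] r_pos[OF x, of k] by (intro mult_mono r_le x k) auto
      then show "\<bar>(deriv ^^ k) u x\<bar> \<le> R / \<epsilon> ^ m * M u"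
        using p_upper[OF u k x] by (simp add: mult_ac)
    qed
    show "M (L s u) \<le> q * M u" if u: "u \<in> V" for u
      unfolding M_def q_def
      by (rule triangular_sum_bound) (use p_Lam[OF u] p_nonneg[OF u] \<epsilon> D in auto)
    show "u = (\<lambda>x. 0)" if "u \<in> V" "Cm_norm m H u = 0" for u
      using that by (rule Cm_norm_definite[OF bounded_H])
    show "L s u \<in> V" if "u \<in> V" for u using that by (rule Lam_mem)
    show "L s (\<lambda>x. a * u x + b * v x) x = a * L s u x + b * L s v x" for u v a b x by (rule Lam_linear)
    show "\<exists>l\<in>V. (\<lambda>n. Cm_norm m H (\<lambda>x. u n x - l x)) \<longlonglongrightarrow> 0"
      if "\<And>n. u n \<in> V" "0 \<le> q" "q < 1" "\<And>n. Cm_norm m H (\<lambda>x. u (Suc n) x - u n x) \<le> A * q ^ n"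
      for u A and q :: real
      using that by (rule Cm_norm_complete[OF open_H bounded_H H_ne])
  qed
qed

end

section \<open>The spectral radius as an infimum\<close>

context transfer_operator
begin

section \<open>Existence of admissible numbers and their distance from 0\<close>

lemma weight_bounded:
  assumes "b \<in> B"
  obtains C where "C > 0" "\<And>x. x \<in> H \<Longrightarrow> g b x powr s \<le> C"
proof -
  obtain C where "C > 0" "\<And>x. x \<in> H \<Longrightarrow> \<bar>g b x powr s\<bar> \<le> C"
    by (rule ext_continuous_bounded[OF Cm_ext_imp_ext_continuous[OF weight_Cm[OF assms]] bounded_H]) blast
  then show thesis using that by fastforce
qed

lemma admissible_exists: "\<exists>c. admissible s c"
proof -
  have "ext_continuous H (\<lambda>x. \<Sum>b\<in>B. g b x powr s)"
    using Cm_ext_sum[OF open_H finite_B weight_Cm] by (rule Cm_ext_imp_ext_continuous)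
  then obtain C where C: "\<And>x. x \<in> H \<Longrightarrow> \<bar>\<Sum>b\<in>B. g b x powr s\<bar> \<le> C"
    using bounded_H by (rule ext_continuous_bounded) blast
  have "(\<Sum>b\<in>B. g b x powr s) \<le> C" if "x \<in> H" for x using C[OF that] by simp
  then have "admissible s C" unfolding admissible_def
    by (intro exI[of _ "\<lambda>_. 1"] exI[of _ 1]) simp
  then show ?thesis ..
qed

text \<open>A single branch suffices. If its weight is at least \<open>k\<close> on
  \<open>H\<close>, then near the positive infimum of \<open>\<eta>\<close> the admissibility
  inequality forces \<open>k \<le> c\<close>.\<close>

lemma admissible_lower_bound: "\<exists>\<delta>>0. \<forall>c. admissible s c \<longrightarrow> \<delta> \<le> c"
proof -
  obtain b where b: "b \<in> B" using B_ne by blast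
  obtain x0 where x0: "x0 \<in> H" using H_ne by blast
  \<comment> \<open>An upper bound for the exponent \<open>- s\<close> is a positive lower bound for
    the weight with exponent \<open>s\<close>.\<close>
  obtain C where C: "C > 0" "\<And>x. x \<in> H \<Longrightarrow> g b x powr (- s) \<le> C"
    using weight_bounded[OF b] by metis
  define k where "k = 1 / C"
  have k: "0 < k" using C(1) by (simp add: k_def)
  have low: "k \<le> g b x powr s" if "x \<in> H" for x
    unfolding k_def using C(2)[OF that] C(1) g_pos[OF b H_closure[OF that]] by (simp add: powr_minus field_simps)
  have "k \<le> c" if adm: "admissible s c" for c
  proof (rule ccontr)
    assume less: "\<not> k \<le> c"
    obtain \<eta> a where a: "0 < a" and \<eta>: "\<And>x. x \<in> H \<Longrightarrow> a \<le> \<eta> x"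
      and sub: "\<And>x. x \<in> H \<Longrightarrow> (\<Sum>i\<in>B. g i x powr s * \<eta> (\<theta> i x)) \<le> c * \<eta> x"
      using adm unfolding admissible_def by blast
    define \<iota> where "\<iota> = (INF x\<in>H. \<eta> x)"
    have bdd: "bdd_below (\<eta> ` H)" by (rule bdd_belowI2[OF \<eta>])
    have \<iota>: "a \<le> \<iota>" "\<And>x. x \<in> H \<Longrightarrow> \<iota> \<le> \<eta> x"
      unfolding \<iota>_def using cINF_greatest[OF H_ne \<eta>] cINF_lower[OF bdd] by auto
    have key: "k * \<iota> \<le> c * \<eta> x" if x: "x \<in> H" for x
    proof -
      have "k * \<iota> \<le> g b x powr s * \<eta> (\<theta> b x)"
        using low[OF x] \<iota>(2)[OF \<theta>_mem[OF b x]] \<iota>(1) a by (intro mult_mono) auto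
      also have "\<dots> \<le> (\<Sum>i\<in>B. g i x powr s * \<eta> (\<theta> i x))"
      proof (rule member_le_sum[OF b _ finite_B])
        show "0 \<le> g i x powr s * \<eta> (\<theta> i x)" if "i \<in> B - {b}" for i
          using \<eta>[OF \<theta>_mem[OF _ x], of i] a that by simp
      qed
      finally show ?thesis using sub[OF x] by linarith
    qed
    have pos: "0 < k * \<iota>" using k \<iota>(1) a by simp
    then have "0 < c * \<eta> x0" using key[OF x0] by linarith
    then have c: "0 < c" using \<eta>[OF x0] a by (simp add: zero_less_mult_iff)
    \<comment> \<open>The infimum need not be attained, so the inequality is divided by
      \<open>c\<close> at every point before passing to the infimum.\<close>
    have "k * \<iota> / c \<le> \<eta> x" if "x \<in> H" for x
      using key[OF that] c by (simp add: pos_divide_le_eq mult.commute)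
    then have "k * \<iota> / c \<le> \<iota>"
      by (subst (2) \<iota>_def) (rule cINF_greatest[OF H_ne])
    then have "k * \<iota> \<le> c * \<iota>" using c by (simp add: divide_le_eq mult.commute)
    then show False using less \<iota>(1) a by simp
  qed
  then show ?thesis using k by (intro exI[of _ k]) simp
qed

definition radius :: "real \<Rightarrow> real" where
  "radius s = Inf {c. admissible s c}"

lemma bdd_below_admissible: "bdd_below {c. admissible s c}"
  using admissible_lower_bound[of s] by (auto intro: bdd_belowI)

lemma radius_le: "admissible s c \<Longrightarrow> radius s \<le> c"
  unfolding radius_def by (rule cInf_lower[OF _ bdd_below_admissible]) simp

text \<open>Makes the logarithm of the radius a genuine one and allows approximation up to a factor
  instead of a summand.\<close>

lemma radius_pos: "0 < radius s"
proof -
  obtain \<delta> where \<delta>: "\<delta> > 0" "\<And>c. admissible s c \<Longrightarrow> \<delta> \<le> c" using admissible_lower_bound by blast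
  have "\<delta> \<le> radius s"
    unfolding radius_def using admissible_exists \<delta>(2) by (intro cInf_greatest) auto
  then show ?thesis using \<delta>(1) by simp
qed

lemma admissible_near_radius:
  assumes "radius s < d"
  obtains c where "admissible s c" "c < d"
  using assms cInf_lessD[of "{c. admissible s c}" d] admissible_exists unfolding radius_def by blast

text \<open>At an approximate minimum of \<open>h / \<eta>\<close> a negative value would contradict \<open>c0 < c\<close>.\<close>

lemma minimum_principle:
  assumes "admissible s c0" "c0 < c" "0 < c" and bound: "\<And>x. x \<in> H \<Longrightarrow> \<bar>h x\<bar> \<le> M"
    and eq: "\<And>x. x \<in> H \<Longrightarrow> c * h x = 1 + (\<Sum>i\<in>B. g i x powr s * h (\<theta> i x))"
    and x: "x \<in> H"
  shows "1 / c \<le> h x"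
proof -
  obtain \<eta> a where a: "0 < a" and \<eta>: "\<And>x. x \<in> H \<Longrightarrow> a \<le> \<eta> x"
    and sub: "\<And>x. x \<in> H \<Longrightarrow> (\<Sum>i\<in>B. g i x powr s * \<eta> (\<theta> i x)) \<le> c0 * \<eta> x"
    using assms(1) unfolding admissible_def by blast
  have \<eta>_pos: "0 < \<eta> x" if "x \<in> H" for x using \<eta>[OF that] a by simp
  define \<iota> where "\<iota> = (INF x\<in>H. h x / \<eta> x)"
  have "- (M / a) \<le> h x / \<eta> x" if "x \<in> H" for x
  proof -
    have "\<bar>h x\<bar> / \<eta> x \<le> M / a" using bound[OF that] \<eta>[OF that] a by (intro frac_le) auto
    then show ?thesis using \<eta>_pos[OF that] abs_divide[of "h x" "\<eta> x"] by linarith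
  qed
  then have bdd: "bdd_below ((\<lambda>x. h x / \<eta> x) ` H)" by (rule bdd_belowI2)
  have h_ge: "\<iota> * \<eta> x \<le> h x" if "x \<in> H" for x
    using cINF_lower[OF bdd that] \<eta>_pos[OF that] unfolding \<iota>_def[symmetric] by (simp add: le_divide_eq)
  have Lh: "\<iota> * (\<Sum>i\<in>B. g i x powr s * \<eta> (\<theta> i x)) \<le> (\<Sum>i\<in>B. g i x powr s * h (\<theta> i x))"
    if x: "x \<in> H" for x
    unfolding sum_distrib_left
  proof (rule sum_mono)
    fix i assume i: "i \<in> B"
    show "\<iota> * (g i x powr s * \<eta> (\<theta> i x)) \<le> g i x powr s * h (\<theta> i x)"
      using mult_left_mono[OF h_ge[OF \<theta>_mem[OF i x]], of "g i x powr s"] by (simp add: mult_ac)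
  qed
  have "0 \<le> \<iota>"
  proof (rule ccontr)
    assume neg: "\<not> 0 \<le> \<iota>"
    have "\<iota> * c0 / c \<le> h x / \<eta> x" if x: "x \<in> H" for x
    proof -
      \<comment> \<open>A negative \<open>\<iota>\<close> reverses the admissibility inequality. The
        outcome is the lower bound \<open>\<iota> * c0 / c\<close> for \<open>h / \<eta>\<close>,
        which would exceed the infimum \<open>\<iota>\<close>.\<close>
      have "\<iota> * (c0 * \<eta> x) \<le> \<iota> * (\<Sum>i\<in>B. g i x powr s * \<eta> (\<theta> i x))"
        using sub[OF x] neg by (intro mult_left_mono_neg) auto
      then have "\<iota> * c0 * \<eta> x \<le> c * h x" using eq[OF x] Lh[OF x] by (simp add: mult.assoc)
      then show ?thesis using assms(3) \<eta>_pos[OF x] by (simp add: field_simps)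
    qed
    then have "\<iota> * c0 / c \<le> \<iota>"
      by (subst (2) \<iota>_def) (rule cINF_greatest[OF H_ne])
    then have "\<iota> * c0 \<le> \<iota> * c" using assms(3) by (simp add: divide_le_eq)
    then show False using neg assms(2) by simp
  qed
  \<comment> \<open>With \<open>\<iota>\<close> nonnegative, \<open>h\<close> dominates a
    nonnegative multiple of \<open>\<eta>\<close>. The sum in the equation for \<open>h\<close> is
    then nonnegative, which leaves \<open>c * h x\<close> at least 1.\<close>
  moreover have "0 \<le> (\<Sum>i\<in>B. g i x powr s * \<eta> (\<theta> i x))"
    using \<eta>_pos[OF \<theta>_mem[OF _ x]] by (intro sum_nonneg) (simp add: less_imp_le)
  ultimately have "0 \<le> \<iota> * (\<Sum>i\<in>B. g i x powr s * \<eta> (\<theta> i x))" by simp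
  then have "1 \<le> c * h x" using eq[OF x] Lh[OF x] by linarith
  then show ?thesis using assms(3) by (simp add: divide_le_eq mult.commute)
qed

end

context contracting_transfer_operator
begin

lemma radius_not_in_resolvent_set:
  "complex_of_real (radius s) \<notin> resolvent_set V (Cm_norm m H) (L s)"
proof
  let ?N = "Cm_norm m H" and ?r = "radius s"
  let ?T = "\<lambda>c f x. complex_of_real c * f x - cplx_op (L s) f x"
  assume "complex_of_real ?r \<in> resolvent_set V ?N (L s)"
  then obtain C0 where C0: "\<And>f. f \<in> cplx_space V \<Longrightarrow> cplx_norm ?N f \<le> C0 * cplx_norm ?N (?T ?r f)"
    unfolding resolvent_set_def by blast
  define C where "C = max C0 1"
  interpret N: seminormed_functions V ?N
    by (rule seminormed_functions_Cm[OF open_H bounded_H H_ne])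
  define one where "one = (\<lambda>x. if x \<in> closure H then 1 else 0 :: real)"
  have "Cm_ext m H one"
    by (rule Cm_ext_cong[OF open_H _ Cm_ext_const[of m H 1]]) (simp add: one_def H_closure)
  moreover have "continuous_on (closure H) one"
    by (rule continuous_on_eq[OF continuous_on_const[of _ 1]]) (simp add: one_def)
  ultimately have one: "one \<in> V" by (simp add: Cm_space_iff one_def)
  define M where "M = 2 * C * (?N one + 1)"
  have C: "1 \<le> C" by (simp add: C_def)
  have M: "0 < M" unfolding M_def using C N.N_nonneg[OF one] by (intro mult_pos_pos) auto
  \<comment> \<open>The first bound lets the perturbation \<open>c - ?r\<close> be absorbed in the
    norm estimate for \<open>h\<close>; the second places \<open>c - 1 / M\<close> below the
    radius.\<close>
  define \<delta> where "\<delta> = min (1 / (2 * C)) (1 / M)"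
  have \<delta>: "0 < \<delta>" using C M by (simp add: \<delta>_def)
  obtain c0 where c0: "admissible s c0" "c0 < ?r + \<delta> / 2"
    using admissible_near_radius[of s "?r + \<delta> / 2"] \<delta> by auto
  \<comment> \<open>Adding \<open>\<delta> / 2\<close> puts \<open>c\<close> strictly above an
    admissible number, so that the resolvent exists at \<open>c\<close>, and still below
    \<open>?r + \<delta>\<close>.\<close>
  define c where "c = c0 + \<delta> / 2"
  have c: "c0 < c" "?r < c" "c < ?r + \<delta>" "0 < c"
    using c0 \<delta> radius_le[OF c0(1)] radius_pos[of s] by (auto simp: c_def)
  have "complex_of_real c \<in> resolvent_set V ?N (L s)"
    using resolvent_of_admissible[OF c0(1)] c by simp
  then have "?T c ` cplx_space V = cplx_space V"
    unfolding resolvent_set_def bij_betw_def by simp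
  moreover have "(\<lambda>x. complex_of_real (one x)) \<in> cplx_space V"
    using one N.zero_mem by (simp add: cplx_space_def)
  ultimately have "(\<lambda>x. complex_of_real (one x)) \<in> ?T c ` cplx_space V" by (simp only:)
  then obtain f where f: "(\<lambda>x. complex_of_real (one x)) = ?T c f" "f \<in> cplx_space V" by (rule imageE)
  define h where "h x = Re (f x)" for x
  have h: "h \<in> V" using f(2) unfolding h_def by (rule N.cplx_spaceD)
  have h_eq: "c * h x - L s h x = one x" for x
    using fun_cong[OF f(1), of x] unfolding h_def by (simp add: complex_eq_iff cplx_op_def)
  have of_real_mem: "(\<lambda>x. complex_of_real (u x)) \<in> cplx_space V" if "u \<in> V" for u
    using that N.zero_mem by (simp add: cplx_space_def)
  have norm_of_real: "cplx_norm ?N (\<lambda>x. complex_of_real (u x)) \<le> ?N u" if "u \<in> V" for u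
    using N.cplx_norm_le_Re_Im[OF of_real_mem[OF that]] by (simp add: N.N_zero)
  \<comment> \<open>Because \<open>c * h - L s h\<close> equals \<open>one\<close>, this is the
    image of \<open>h\<close> under the operator at the radius. The assumed bound on the inverse
    there turns it into an estimate for \<open>h\<close>.\<close>
  let ?u = "\<lambda>x. (?r - c) * h x + 1 * one x"
  have u: "?u \<in> V" by (rule N.lincomb_mem[OF h one])
  have "L s (\<lambda>x. 0) = (\<lambda>x. 0)" by (simp add: Lam_def fun_eq_iff)
  then have Tu: "?T ?r (\<lambda>x. complex_of_real (h x)) = (\<lambda>x. complex_of_real (?u x))"
    by (simp add: fun_eq_iff complex_eq_iff cplx_op_def h_eq[symmetric] algebra_simps)
  have "?N h \<le> cplx_norm ?N (\<lambda>x. complex_of_real (h x))"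
    using N.Re_le_cplx_norm[OF of_real_mem[OF h]] by simp
  also have "\<dots> \<le> C0 * cplx_norm ?N (\<lambda>x. complex_of_real (?u x))"
    using C0[OF of_real_mem[OF h]] unfolding Tu .
  also have "\<dots> \<le> C * cplx_norm ?N (\<lambda>x. complex_of_real (?u x))"
    using N.cplx_norm_nonneg[OF of_real_mem[OF u]] by (intro mult_right_mono) (simp_all add: C_def)
  also have "\<dots> \<le> C * ?N ?u"
    using C by (intro mult_left_mono norm_of_real u) simp
  also have "\<dots> \<le> C * ((c - ?r) * ?N h + ?N one)"
    using N.N_lincomb_le[OF h one, of "?r - c" 1] C c by (intro mult_left_mono) auto
  also have "\<dots> = (C * (c - ?r)) * ?N h + C * ?N one" by (simp add: algebra_simps)
  \<comment> \<open>Half of \<open>?N h\<close> can now be moved to the left, which bounds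
    \<open>h\<close> by \<open>M\<close>.\<close>
  also have "\<dots> \<le> 1 / 2 * ?N h + C * ?N one"
  proof -
    have "c - ?r \<le> 1 / (2 * C)" using c(3) by (simp add: \<delta>_def)
    then have "C * (c - ?r) \<le> 1 / 2" using C by (simp add: field_simps)
    then show ?thesis using N.N_nonneg[OF h] by (intro add_right_mono mult_right_mono)
  qed
  finally have "?N h \<le> 2 * C * ?N one" by simp
  also have "\<dots> \<le> M" using C by (simp add: M_def)
  finally have hM: "\<bar>h x\<bar> \<le> M" if "x \<in> H" for x
    using Cm_norm_upper[OF bounded_H h _ that, of 0] by simp
  have eq: "c * h x = 1 + (\<Sum>i\<in>B. g i x powr s * h (\<theta> i x))" if "x \<in> H" for x
    using h_eq[of x] H_closure[OF that] by (simp add: Lam_def one_def)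
  have h_ge: "1 / c \<le> h x" if "x \<in> H" for x
    by (rule minimum_principle[OF c0(1) c(1,4) hM eq that])
  have "(\<Sum>i\<in>B. g i x powr s * h (\<theta> i x)) \<le> (c - 1 / M) * h x" if "x \<in> H" for x
  proof -
    have "h x / M \<le> 1" using hM[OF that] M by (simp add: divide_le_eq)
    then show ?thesis using eq[OF that] by (simp add: left_diff_distrib)
  qed
  \<comment> \<open>The solution \<open>h\<close> itself is the test function, with bounds
    \<open>1 / c\<close> and \<open>M\<close>.\<close>
  then have "admissible s (c - 1 / M)"
    unfolding admissible_def using c(4) h_ge hM
    by (intro exI[of _ h] exI[of _ "1 / c"] exI[of _ M]) (auto simp: abs_le_iff)
  then have "?r \<le> c - 1 / M" by (rule radius_le)
  also have "\<dots> < ?r" using c(3) by (simp add: \<delta>_def)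
  finally show False by simp
qed

text \<open>The supremum is a maximum, attained at the real number \<open>radius s\<close>. Any
  larger modulus exceeds some admissible number and so belongs to the resolvent set.\<close>

theorem spectral_radius_eq: "spectral_radius V (Cm_norm m H) (L s) = radius s"
  unfolding spectral_radius_def
proof (rule cSup_eq_maximum)
  have "cmod (complex_of_real (radius s)) = radius s" using radius_pos[of s] by simp
  then show "radius s \<in> cmod ` (- resolvent_set V (Cm_norm m H) (L s))"
    using radius_not_in_resolvent_set[of s] by (intro rev_image_eqI[of "complex_of_real (radius s)"]) auto
  fix y assume "y \<in> cmod ` (- resolvent_set V (Cm_norm m H) (L s))"
  then obtain z where z: "z \<notin> resolvent_set V (Cm_norm m H) (L s)" "y = cmod z" by blast
  show "y \<le> radius s"
  proof (rule ccontr)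
    assume "\<not> y \<le> radius s"
    then obtain c where "admissible s c" "c < cmod z"
      using admissible_near_radius[of s "cmod z"] z(2) by auto
    then show False using resolvent_of_admissible z(1) by blast
  qed
qed

end

section \<open>Log-convexity\<close>

text \<open>Young's inequality is applied to the normalized terms \<open>x i / X\<close> and
  \<open>y i / Y\<close>, each family of which sums to 1.\<close>

lemma Holder_sum_powr:
  fixes x y :: "'a \<Rightarrow> real"
  assumes "finite A" "A \<noteq> {}" "\<And>i. i \<in> A \<Longrightarrow> 0 < x i" "\<And>i. i \<in> A \<Longrightarrow> 0 < y i" "0 < t" "t < 1"
  shows "(\<Sum>i\<in>A. x i powr (1 - t) * y i powr t) \<le> (\<Sum>i\<in>A. x i) powr (1 - t) * (\<Sum>i\<in>A. y i) powr t"
proof -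
  define X where "X = (\<Sum>i\<in>A. x i)"
  define Y where "Y = (\<Sum>i\<in>A. y i)"
  have pos: "0 < X" "0 < Y" unfolding X_def Y_def using assms by (auto intro!: sum_pos)
  have "x i powr (1 - t) * y i powr t \<le> X powr (1 - t) * Y powr t * ((1 - t) * (x i / X) + t * (y i / Y))"
    if i: "i \<in> A" for i
  proof -
    have "x i powr (1 - t) * y i powr t =
        X powr (1 - t) * Y powr t * ((x i / X) powr (1 - t) * (y i / Y) powr t)"
      using pos assms(3,4)[OF i] by (simp add: powr_divide)
    also have "\<dots> \<le> X powr (1 - t) * Y powr t * ((1 - t) * (x i / X) + t * (y i / Y))"
      using pos assms(3,4)[OF i] assms(5,6) by (intro mult_left_mono Youngs_inequality_0) auto
    finally show ?thesis .
  qed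
  then have "(\<Sum>i\<in>A. x i powr (1 - t) * y i powr t) \<le>
      (\<Sum>i\<in>A. X powr (1 - t) * Y powr t * ((1 - t) * (x i / X) + t * (y i / Y)))"
    by (rule sum_mono)
  also have "\<dots> = X powr (1 - t) * Y powr t * ((1 - t) * ((\<Sum>i\<in>A. x i) / X) + t * ((\<Sum>i\<in>A. y i) / Y))"
    by (simp only: sum_distrib_left[symmetric] sum.distrib sum_divide_distrib[symmetric])
  also have "\<dots> = X powr (1 - t) * Y powr t"
    using pos unfolding X_def[symmetric] Y_def[symmetric] by simp
  finally show ?thesis unfolding X_def Y_def .
qed

context transfer_operator
begin

lemma admissible_powr:
  assumes "admissible s0 c0" "admissible s1 c1" "0 < t" "t < 1"
  shows "admissible ((1 - t) * s0 + t * s1) (c0 powr (1 - t) * c1 powr t)"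
proof -
  obtain \<eta>0 a0 b0 where a0: "0 < a0" and \<eta>0: "\<And>x. x \<in> H \<Longrightarrow> a0 \<le> \<eta>0 x" "\<And>x. x \<in> H \<Longrightarrow> \<eta>0 x \<le> b0"
    and sub0: "\<And>x. x \<in> H \<Longrightarrow> (\<Sum>i\<in>B. g i x powr s0 * \<eta>0 (\<theta> i x)) \<le> c0 * \<eta>0 x"
    using assms(1) unfolding admissible_def by blast
  obtain \<eta>1 a1 b1 where a1: "0 < a1" and \<eta>1: "\<And>x. x \<in> H \<Longrightarrow> a1 \<le> \<eta>1 x" "\<And>x. x \<in> H \<Longrightarrow> \<eta>1 x \<le> b1"
    and sub1: "\<And>x. x \<in> H \<Longrightarrow> (\<Sum>i\<in>B. g i x powr s1 * \<eta>1 (\<theta> i x)) \<le> c1 * \<eta>1 x"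
    using assms(2) unfolding admissible_def by blast
  have pos0: "0 < \<eta>0 x" and pos1: "0 < \<eta>1 x" if "x \<in> H" for x
    using \<eta>0(1)[OF that] \<eta>1(1)[OF that] a0 a1 by auto
  \<comment> \<open>Nonnegativity is what permits splitting the powers of
    \<open>c0 * \<eta>0 x\<close> and \<open>c1 * \<eta>1 x\<close> at the end.\<close>
  have c: "0 \<le> c0" "0 \<le> c1"
    using admissible_lower_bound[of s0] admissible_lower_bound[of s1] assms(1,2) by fastforce+
  define \<eta> where "\<eta> x = \<eta>0 x powr (1 - t) * \<eta>1 x powr t" for x
  have "a0 powr (1 - t) * a1 powr t \<le> \<eta> x" "\<eta> x \<le> b0 powr (1 - t) * b1 powr t" if "x \<in> H" for x
    unfolding \<eta>_def using \<eta>0[OF that] \<eta>1[OF that] a0 a1 assms(3,4)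
    by (intro mult_mono powr_mono2; simp)+
  moreover have "(\<Sum>i\<in>B. g i x powr ((1 - t) * s0 + t * s1) * \<eta> (\<theta> i x)) \<le>
      c0 powr (1 - t) * c1 powr t * \<eta> x" if x: "x \<in> H" for x
  proof -
    let ?p = "\<lambda>i. g i x powr s0 * \<eta>0 (\<theta> i x)" and ?q = "\<lambda>i. g i x powr s1 * \<eta>1 (\<theta> i x)"
    have pos: "0 < ?p i" "0 < ?q i" if i: "i \<in> B" for i
      using g_pos[OF i H_closure[OF x]] pos0[OF \<theta>_mem[OF i x]] pos1[OF \<theta>_mem[OF i x]] by simp_all
    \<comment> \<open>The interpolated weight and test function factor branch by branch, which
      brings the sum into the form of Hoelder's inequality.\<close>
    have "g i x powr ((1 - t) * s0 + t * s1) * \<eta> (\<theta> i x) = ?p i powr (1 - t) * ?q i powr t"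
      if i: "i \<in> B" for i
      using pos0[OF \<theta>_mem[OF i x]] pos1[OF \<theta>_mem[OF i x]]
      by (simp add: \<eta>_def powr_mult powr_powr powr_add mult_ac)
    then have "(\<Sum>i\<in>B. g i x powr ((1 - t) * s0 + t * s1) * \<eta> (\<theta> i x)) =
        (\<Sum>i\<in>B. ?p i powr (1 - t) * ?q i powr t)" by (rule sum.cong[OF refl])
    also have "\<dots> \<le> (\<Sum>i\<in>B. ?p i) powr (1 - t) * (\<Sum>i\<in>B. ?q i) powr t"
      by (rule Holder_sum_powr[OF finite_B B_ne pos assms(3,4)])
    also have "\<dots> \<le> (c0 * \<eta>0 x) powr (1 - t) * (c1 * \<eta>1 x) powr t"
      using sub0[OF x] sub1[OF x] assms(3,4) sum_nonneg[of B ?p] sum_nonneg[of B ?q] pos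
      by (intro mult_mono powr_mono2) (auto simp: less_imp_le)
    also have "\<dots> = c0 powr (1 - t) * c1 powr t * \<eta> x"
      using c pos0[OF x] pos1[OF x] by (simp add: \<eta>_def powr_mult)
    finally show ?thesis .
  qed
  ultimately show ?thesis
    unfolding admissible_def using a0 a1
    by (intro exI[of _ \<eta>] exI[of _ "a0 powr (1 - t) * a1 powr t"] exI[of _ "b0 powr (1 - t) * b1 powr t"]) simp
qed

text \<open>The infima need not be attained, so each is approximated up to a factor
  \<open>exp e\<close>. As the coefficients \<open>1 - t\<close> and \<open>t\<close> sum to 1, the
  total error in the logarithm is again \<open>e\<close>.\<close>

lemma ln_radius_convex:
  assumes "0 < t" "t < 1"
  shows "ln (radius ((1 - t) * s0 + t * s1)) \<le> (1 - t) * ln (radius s0) + t * ln (radius s1)"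
proof (rule field_le_epsilon)
  fix e :: real assume e: "e > 0"
  have near: "\<exists>c>0. admissible s c \<and> ln c \<le> ln (radius s) + e" for s
  proof -
    have "radius s < radius s * exp e" using radius_pos[of s] e by simp
    then obtain c where c: "admissible s c" "c < radius s * exp e" by (rule admissible_near_radius)
    have "0 < c" using radius_le[OF c(1)] radius_pos[of s] by simp
    then have "ln c \<le> ln (radius s * exp e)" using c(2) by simp
    also have "\<dots> = ln (radius s) + e" using radius_pos[of s] by (simp add: ln_mult)
    finally show ?thesis using c(1) \<open>0 < c\<close> by blast
  qed
  obtain c0 where c0: "0 < c0" "admissible s0 c0" "ln c0 \<le> ln (radius s0) + e" using near[of s0] by blast
  obtain c1 where c1: "0 < c1" "admissible s1 c1" "ln c1 \<le> ln (radius s1) + e" using near[of s1] by blast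
  have "ln (radius ((1 - t) * s0 + t * s1)) \<le> ln (c0 powr (1 - t) * c1 powr t)"
    using radius_le[OF admissible_powr[OF c0(2) c1(2) assms]] radius_pos c0(1) c1(1)
    by (subst ln_le_cancel_iff) auto
  also have "\<dots> = (1 - t) * ln c0 + t * ln c1"
    using c0(1) c1(1) by (simp add: ln_mult ln_powr)
  also have "\<dots> \<le> (1 - t) * (ln (radius s0) + e) + t * (ln (radius s1) + e)"
    using assms c0(3) c1(3) by (intro add_mono mult_left_mono) auto
  also have "\<dots> = (1 - t) * ln (radius s0) + t * ln (radius s1) + e" by (simp add: algebra_simps)
  finally show "ln (radius ((1 - t) * s0 + t * s1)) \<le> (1 - t) * ln (radius s0) + t * ln (radius s1) + e" .
qed

end

theorem theorem8p1:
  fixes H :: "real set" and B :: "'b set" and m :: nat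
    and g \<theta> :: "'b \<Rightarrow> real \<Rightarrow> real"
  assumes "open H" and "bounded H" and "finite B" and "m \<ge> 1"
    and H41: "\<forall>b\<in>B. Cm_closure m H (g b) \<and> (\<forall>x\<in>closure H. g b x > 0)"
    and H42: "\<forall>b\<in>B. Cm_closure m H (\<theta> b) \<and> \<theta> b ` H \<subseteq> H"
    and H43: "\<exists>\<mu>::nat. \<exists>\<kappa>::real. \<mu> > 0 \<and> \<kappa> < 1 \<and>
               (\<forall>\<omega>. set \<omega> \<subseteq> B \<and> length \<omega> = \<mu> \<longrightarrow>
                 (\<forall>x\<in>H. \<forall>y\<in>H. \<bar>theta_word \<theta> \<omega> x - theta_word \<theta> \<omega> y\<bar> \<le> \<kappa> * \<bar>x - y\<bar>))"
  shows "convex_on {0..} (\<lambda>s. ln (spectral_radius (Cm_space m H) (Cm_norm m H) (Lam H B g \<theta> s)))"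
proof (cases "H = {} \<or> B = {}")
  case True
  \<comment> \<open>An empty index set gives empty sums and an empty \<open>H\<close> has empty
    closure. The operator is then the same for all \<open>s\<close>, and a constant function is
    convex whatever its value.\<close>
  then have "Lam H B g \<theta> = (\<lambda>s w x. 0)" by (auto simp: Lam_def fun_eq_iff)
  then show ?thesis by (simp only:, intro convex_onI) (simp_all add: algebra_simps)
next
  case False
  obtain \<mu> :: nat and \<kappa> :: real where \<mu>: "\<mu> > 0" "\<kappa> < 1"
    "\<And>\<omega> x y. set \<omega> \<subseteq> B \<Longrightarrow> length \<omega> = \<mu> \<Longrightarrow> x \<in> H \<Longrightarrow> y \<in> H \<Longrightarrow>
      \<bar>theta_word \<theta> \<omega> x - theta_word \<theta> \<omega> y\<bar> \<le> \<kappa> * \<bar>x - y\<bar>"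
    using H43 by blast
  interpret contracting_transfer_operator H B m g \<theta> \<mu> \<kappa>
    using assms(1-4) False H41 H42 \<mu> by unfold_locales (auto simp: Cm_closure_iff)
  show ?thesis
    unfolding spectral_radius_eq by (rule convex_onI) (use ln_radius_convex in auto)
qed

end
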